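(* Let $\mathbb{R}^n=\mathbb{R}^{2d}$ carry its canonical symplectic form and Poisson bracket. Let $A,B\in\operatorname{Sym}(n,\mathbb{R})$ be linearly independent, form a non-dissipative pair, and satisfy $\operatorname{maxrank}\{A,B\}\ge7$. Let $C\in\operatorname{Sym}(n,\mathbb{R})$ be given by $Q_C=\{Q_A,Q_B\}$, and assume $Q_C$ vanishes on $\{Q_A=0\}\cap\{Q_B=0\}$. Assume further that $\ker A\cap\ker B$ is either $\{0\}$ or a symplectic subspace of $\mathbb{R}^n$, and that no connected component of $\mathcal{N}$ spans $\mathbb{R}^n$. Then $C$ is a linear combination of $A$ and $B$.
   Context: $Q_M(z)={}^tzMz$. Canonical Poisson bracket on $\mathbb{R}^{2d}$ with coordinates $(x,\xi)$: $\{a,b\}=\sum_j(\partial_{\xi_j}a\,\partial_{x_j}b-\partial_{x_j}a\,\partial_{\xi_j}b)$. Non-dissipative pair: $0$ is the only positive semidefinite element of $\operatorname{span}_{\mathbb{R}}\{A,B\}$; $\operatorname{maxrank}\{A,B\}$ is the maximal rank of elements of this span. $\mathcal{N}:=\{z\in\mathbb{R}^n:Q_A(z)=Q_B(z)=0,\ Az\text{ and }Bz\text{ linearly independent}\}$, an analytic submanifold of codimension 2; a connected component spans $\mathbb{R}^n$ if its linear span is $\mathbb{R}^n$. *)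

theory Defs
  imports "HOL-Analysis.Analysis"
begin

text \<open>Phase space R^n = R^{2d}: vectors indexed by 'd + 'd, with
  x_j = z $ Inl j and xi_j = z $ Inr j.\<close>

type_synonym 'd phase = "real ^ ('d + 'd)"
type_synonym 'd smat = "real ^ ('d + 'd) ^ ('d + 'd)"

definition symmetric_mat :: "'d::finite smat \<Rightarrow> bool" where
  "symmetric_mat M \<longleftrightarrow> transpose M = M"

definition Qf :: "'d::finite smat \<Rightarrow> 'd phase \<Rightarrow> real" where
  "Qf M z = z \<bullet> (M *v z)"

definition pderiv_at :: "('d::finite phase \<Rightarrow> real) \<Rightarrow> ('d + 'd) \<Rightarrow> 'd phase \<Rightarrow> real" where
  "pderiv_at f i z = frechet_derivative f (at z) (axis i 1)"

definition poisson :: "('d::finite phase \<Rightarrow> real) \<Rightarrow> ('d phase \<Rightarrow> real) \<Rightarrow> 'd phase \<Rightarrow> real" where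
  "poisson a b z = (\<Sum>j\<in>UNIV. pderiv_at a (Inr j) z * pderiv_at b (Inl j) z
                              - pderiv_at a (Inl j) z * pderiv_at b (Inr j) z)"

definition symp_form :: "'d::finite phase \<Rightarrow> 'd phase \<Rightarrow> real" where
  "symp_form u v = (\<Sum>j\<in>UNIV. u $ Inr j * v $ Inl j - u $ Inl j * v $ Inr j)"

definition symplectic_subspace :: "'d::finite phase set \<Rightarrow> bool" where
  "symplectic_subspace V \<longleftrightarrow> subspace V \<and>
     (\<forall>u\<in>V. (\<forall>v\<in>V. symp_form u v = 0) \<longrightarrow> u = 0)"

definition pos_semidef :: "'d::finite smat \<Rightarrow> bool" where
  "pos_semidef M \<longleftrightarrow> symmetric_mat M \<and> (\<forall>z. Qf M z \<ge> 0)"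

definition non_dissipative :: "'d::finite smat \<Rightarrow> 'd smat \<Rightarrow> bool" where
  "non_dissipative A B \<longleftrightarrow>
     (\<forall>s t. pos_semidef (s *\<^sub>R A + t *\<^sub>R B) \<longrightarrow> s *\<^sub>R A + t *\<^sub>R B = 0)"

definition maxrank :: "'d::finite smat \<Rightarrow> 'd smat \<Rightarrow> nat" where
  "maxrank A B = Max {rank (s *\<^sub>R A + t *\<^sub>R B) | s t. True}"

definition lin_indep2 :: "'a::real_vector \<Rightarrow> 'a \<Rightarrow> bool" where
  "lin_indep2 u v \<longleftrightarrow> (\<forall>s t. s *\<^sub>R u + t *\<^sub>R v = 0 \<longrightarrow> s = 0 \<and> t = 0)"

definition Nset :: "'d::finite smat \<Rightarrow> 'd smat \<Rightarrow> 'd phase set" where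
  "Nset A B = {z. Qf A z = 0 \<and> Qf B z = 0 \<and> lin_indep2 (A *v z) (B *v z)}"

end

theory Submission
  imports Defs
begin

text \<open>
  If the span of \<open>A\<close> and \<open>B\<close> has no form with two positive and two negative squares, then by
  connectedness of the circle of forms it has a nonzero form of rank at most two. Otherwise an explicit
  construction gives a regular common zero, unless again some form has rank two. At a regular zero whose
  component of \<open>\<N>\<close> lies in a hyperplane \<open>H\<close>, the tangent spaces \<open>{Az, Bz}\<^sup>\<bottom>\<close> lie in \<open>H\<close>, which forces
  some form of the span to vanish on \<open>H\<close>. In every case the span contains a product \<open>l m\<close> of linear forms.

  For such a form and a complementary one \<open>G\<close>, the bracket is a multiple of \<open>l G(Jm, \<cdot>) + m G(Jl, \<cdot>)\<close>. Where
  \<open>G\<close> is indefinite on \<open>l = 0\<close>, the S-lemma and the rank bound force \<open>G(Jl, \<cdot>)\<close> to be a multiple of \<open>l\<close>, and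
  likewise for \<open>m\<close>; if both happen the bracket is a multiple of \<open>l m\<close>. If \<open>G\<close> is semidefinite on \<open>m = 0\<close>,
  then \<open>Jl\<close> lies in the common kernel and is symplectically orthogonal to it, contrary to assumption.
\<close>

section \<open>Symmetric bilinear forms\<close>

text \<open>Quadratic forms enter through their polar forms on an arbitrary real vector space, so
  that negatives and rotated pencils can be formed without matrices.\<close>

definition sym_bilinear :: "('a::real_vector \<Rightarrow> 'a \<Rightarrow> real) \<Rightarrow> bool" where
  "sym_bilinear a \<longleftrightarrow> bilinear a \<and> (\<forall>x y. a x y = a y x)"

lemma sym_bilinear_commute: "sym_bilinear a \<Longrightarrow> a x y = a y x"
  by (simp add: sym_bilinear_def)

lemma sym_bilinear_simps:
  assumes "sym_bilinear a"
  shows "a (x + y) z = a x z + a y z" "a z (x + y) = a z x + a z y"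
    "a (x - y) z = a x z - a y z" "a z (x - y) = a z x - a z y"
    "a (c *\<^sub>R x) z = c * a x z" "a z (c *\<^sub>R x) = c * a z x"
    "a 0 z = 0" "a z 0 = 0"
  using assms unfolding sym_bilinear_def
  by (auto simp: bilinear_ladd bilinear_radd bilinear_lsub bilinear_rsub bilinear_lmul bilinear_rmul
      bilinear_lzero bilinear_rzero)

lemma sym_bilinear_linear: "sym_bilinear a \<Longrightarrow> linear (a x)"
  by (simp add: sym_bilinear_def bilinear_def)

lemma sym_bilinear_combination:
  assumes "sym_bilinear a" "sym_bilinear b"
  shows "sym_bilinear (\<lambda>x y. s * a x y + t * b x y)"
  unfolding sym_bilinear_def bilinear_def linear_iff
  using sym_bilinear_simps[OF assms(1)] sym_bilinear_simps[OF assms(2)]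
    sym_bilinear_commute[OF assms(1)] sym_bilinear_commute[OF assms(2)]
  by (simp add: algebra_simps)

lemma linear_real_combination:
  fixes f g :: "'a::real_vector \<Rightarrow> real"
  assumes "linear f" "linear g"
  shows "linear (\<lambda>x. s * f x + t * g x)"
  using assms by (auto simp: linear_iff algebra_simps)

lemma sym_bilinear_line:
  assumes "sym_bilinear a"
  shows "a (x + c *\<^sub>R y) (x + c *\<^sub>R y) = a x x + 2 * c * a x y + c\<^sup>2 * a y y"
  by (simp add: sym_bilinear_simps[OF assms] sym_bilinear_commute[OF assms, of y x]
      power2_eq_square algebra_simps)

text \<open>Polarization: the diagonal value at \<open>x + y\<close> leaves only twice the mixed
  term.\<close>

lemma sym_bilinear_eq_0I:
  assumes "sym_bilinear a" "subspace V" "\<And>x. x \<in> V \<Longrightarrow> a x x = 0" "x \<in> V" "y \<in> V"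
  shows "a x y = 0"
  using assms(3)[of "x + y"] assms(3)[of x] assms(3)[of y] assms
  by (simp add: sym_bilinear_simps[OF assms(1)] sym_bilinear_commute[OF assms(1), of y x] subspace_add)

section \<open>Indefinite forms and the S-lemma\<close>

lemma indefinite_quadratic_roots:
  fixes P R S :: real
  assumes "P > 0" "S < 0"
  obtains c d where "c < 0" "0 < d" "P + 2 * c * R + c\<^sup>2 * S = 0" "P + 2 * d * R + d\<^sup>2 * S = 0"
    "c * d * S = P"
proof -
  \<comment> \<open>The roots are \<open>(e - R) / S\<close> and \<open>(- e - R) / S\<close>; their
    product \<open>P / S\<close> is negative, which gives the opposite signs.\<close>
  define e where "e = sqrt (R\<^sup>2 - P * S)"
  have "P * S < 0" using assms by (simp add: mult_pos_neg)
  then have "R\<^sup>2 < R\<^sup>2 - P * S" by simp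
  moreover have "0 \<le> R\<^sup>2" by simp
  ultimately have "0 \<le> R\<^sup>2 - P * S" by linarith
  then have e2: "e\<^sup>2 = R\<^sup>2 - P * S" by (simp add: e_def)
  have "e > \<bar>R\<bar>"
    unfolding e_def using \<open>R\<^sup>2 < R\<^sup>2 - P * S\<close> by (intro real_less_rsqrt) simp
  have P: "P = (R\<^sup>2 - e\<^sup>2) / S" using e2 assms by simp
  show ?thesis
  proof
    show "(e - R) / S < 0" "0 < (- e - R) / S"
      using \<open>e > \<bar>R\<bar>\<close> assms by (auto simp: divide_simps)
    show "P + 2 * ((e - R) / S) * R + ((e - R) / S)\<^sup>2 * S = 0"
      "P + 2 * ((- e - R) / S) * R + ((- e - R) / S)\<^sup>2 * S = 0"
      "((e - R) / S) * ((- e - R) / S) * S = P"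
      using assms unfolding P by (simp_all add: field_simps power2_eq_square)
  qed
qed

text \<open>A suitable \<open>t\<close> must be at least \<open>- (b x x / a x x)\<close> where
  \<open>a\<close> is positive and at most this quotient where \<open>a\<close> is negative.
  \<open>key\<close> compares a lower with an upper bound on the line through two such vectors,
  which contains two zeros of \<open>a\<close>.\<close>

lemma s_lemma:
  assumes a: "sym_bilinear a" and b: "sym_bilinear b" and V: "subspace V"
    and p: "p \<in> V" "a p p > 0" and q: "q \<in> V" "a q q < 0"
    and nonneg: "\<And>x. x \<in> V \<Longrightarrow> a x x = 0 \<Longrightarrow> b x x \<ge> 0"
  shows "\<exists>t. \<forall>x\<in>V. b x x + t * a x x \<ge> 0"
proof -
  have key: "- (b x x / a x x) \<le> - (b y y / a y y)"
    if xy: "x \<in> V" "y \<in> V" "a x x > 0" "a y y < 0" for x y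
  proof -
    obtain c d where cd: "c < 0" "0 < d" "a x x + 2 * c * a x y + c\<^sup>2 * a y y = 0"
      "a x x + 2 * d * a x y + d\<^sup>2 * a y y = 0" "c * d * a y y = a x x"
      using indefinite_quadratic_roots[OF xy(3,4)] by blast
    have mem: "x + r *\<^sub>R y \<in> V" for r using xy V by (simp add: subspace_add subspace_scale)
    have 1: "b x x + 2 * c * b x y + c\<^sup>2 * b y y \<ge> 0"
      using nonneg[OF mem[of c]] cd by (simp add: sym_bilinear_line a b)
    have 2: "b x x + 2 * d * b x y + d\<^sup>2 * b y y \<ge> 0"
      using nonneg[OF mem[of d]] cd by (simp add: sym_bilinear_line a b)
    \<comment> \<open>The positive weights \<open>d\<close> and \<open>- c\<close> cancel the mixed
      term \<open>b x y\<close>.\<close>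
    have "0 \<le> d * (b x x + 2 * c * b x y + c\<^sup>2 * b y y) + (- c) * (b x x + 2 * d * b x y + d\<^sup>2 * b y y)"
      by (rule add_nonneg_nonneg[OF mult_nonneg_nonneg[OF _ 1] mult_nonneg_nonneg[OF _ 2]]) (use cd in auto)
    also have "\<dots> = (d - c) * (b x x - c * d * b y y)"
      by (simp add: algebra_simps power2_eq_square)
    finally have "b x x - c * d * b y y \<ge> 0"
      using cd by (simp add: zero_le_mult_iff)
    moreover have "c * d = a x x / a y y" using cd(5) xy by (simp add: field_simps)
    ultimately have "b x x - (a x x / a y y) * b y y \<ge> 0" by simp
    then show ?thesis using xy by (simp add: divide_simps mult.commute split: if_splits)
  qed
  \<comment> \<open>\<open>X\<close> is the set of lower bounds. By \<open>key\<close> the vector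
    \<open>q\<close> bounds it above, and its supremum serves as \<open>t\<close>.\<close>
  define X where "X = (\<lambda>x. - (b x x / a x x)) ` {x \<in> V. a x x > 0}"
  have "X \<noteq> {}" using p by (auto simp: X_def)
  have bdd: "bdd_above X" unfolding X_def bdd_above_def using key q by blast
  show ?thesis
  proof (intro exI ballI)
    fix x assume x: "x \<in> V"
    consider "a x x = 0" | "a x x > 0" | "a x x < 0" by linarith
    then show "b x x + Sup X * a x x \<ge> 0"
    proof cases
      case 1 then show ?thesis using nonneg x by simp
    next
      case 2
      then have "- (b x x / a x x) \<le> Sup X"
        using x bdd by (auto simp: X_def intro!: cSup_upper)
      then show ?thesis using 2 by (simp add: field_simps)
    next
      case 3
      have "Sup X \<le> - (b x x / a x x)"
        using x \<open>X \<noteq> {}\<close> key 3 by (intro cSup_least) (auto simp: X_def)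
      then show ?thesis using 3 by (simp add: field_simps)
    qed
  qed
qed

text \<open>The S-lemma for \<open>b\<close> and for \<open>- b\<close> bounds \<open>b\<close> from
  both sides by multiples of \<open>a\<close>; the two multiples agree because \<open>a\<close>
  takes both signs.\<close>

lemma proportional_on_isotropic_cone:
  assumes a: "sym_bilinear a" and b: "sym_bilinear b" and V: "subspace V"
    and p: "p \<in> V" "a p p > 0" and q: "q \<in> V" "a q q < 0"
    and zero: "\<And>x. x \<in> V \<Longrightarrow> a x x = 0 \<Longrightarrow> b x x = 0"
  shows "\<exists>t. \<forall>x\<in>V. b x x = t * a x x"
proof -
  have b': "sym_bilinear (\<lambda>x y. - b x y)"
    using sym_bilinear_combination[OF b b, of "-1" 0] by simp
  obtain t where t: "\<forall>x\<in>V. b x x + t * a x x \<ge> 0"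
    using s_lemma[OF a b V p q] zero by fastforce
  obtain t' where t': "\<forall>x\<in>V. - b x x + t' * a x x \<ge> 0"
    using s_lemma[OF a b' V p q] zero by fastforce
  have "(t + t') * a x x \<ge> 0" if "x \<in> V" for x
    using t t' that by (force simp: algebra_simps)
  from this[OF p(1)] this[OF q(1)] have "t + t' = 0"
    using p q by (simp add: zero_le_mult_iff)
  then have "t' = - t" by simp
  with t t' show ?thesis by (intro exI[of _ "-t"]) (force simp: algebra_simps)
qed

text \<open>The line through a positive vector in the direction of a negative one contains two
  isotropic vectors. If \<open>f\<close> killed both, it would kill the positive vector too, which
  is first moved off the kernel of \<open>f\<close>.\<close>

lemma isotropic_off_hyperplane:
  assumes a: "sym_bilinear a" and V: "subspace V"
    and p: "p \<in> V" "a p p > 0" and q: "q \<in> V" "a q q < 0"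
    and f: "linear f" and e: "e \<in> V" "f e \<noteq> (0::real)"
  shows "\<exists>w\<in>V. a w w = 0 \<and> f w \<noteq> 0 \<and> (\<exists>y. a w y \<noteq> 0)"
proof -
  interpret f: linear f by fact
  obtain p' where p': "p' \<in> V" "a p' p' > 0" "f p' \<noteq> 0"
  proof (cases "f p = 0")
    case False then show ?thesis using p that by blast
  next
    case True
    \<comment> \<open>A small step along \<open>e\<close> leaves the kernel of \<open>f\<close> and
      keeps \<open>a\<close> positive.\<close>
    have "((\<lambda>r. a p p + 2 * r * a p e + r\<^sup>2 * a e e) \<longlongrightarrow> a p p + 2 * 0 * a p e + 0\<^sup>2 * a e e) (at_right 0)"
      by (intro tendsto_intros)
    then have "\<forall>\<^sub>F r in at_right 0. a p p + 2 * r * a p e + r\<^sup>2 * a e e > 0"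
      using p by (auto dest: order_tendstoD)
    then have "\<forall>\<^sub>F r in at_right 0. a p p + 2 * r * a p e + r\<^sup>2 * a e e > 0 \<and> r > 0"
      using eventually_at_right_less by (rule eventually_conj)
    then obtain r where r: "a p p + 2 * r * a p e + r\<^sup>2 * a e e > 0" "r > 0"
      by (metis (mono_tags, lifting) eventually_happens' trivial_limit_at_right_real)
    show ?thesis
    proof (rule that)
      show "p + r *\<^sub>R e \<in> V" using p e V by (simp add: subspace_add subspace_scale)
    qed (use r e True in \<open>simp_all add: sym_bilinear_line[OF a] f.add f.scale\<close>)
  qed
  obtain c d where cd: "c < 0" "0 < d" "a p' p' + 2 * c * a p' q + c\<^sup>2 * a q q = 0"
      "a p' p' + 2 * d * a p' q + d\<^sup>2 * a q q = 0"
    using indefinite_quadratic_roots[OF p'(2) q(2)] by blast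
  have "f (p' + c *\<^sub>R q) \<noteq> 0 \<or> f (p' + d *\<^sub>R q) \<noteq> 0"
  proof (rule ccontr)
    assume "\<not> ?thesis"
    then have "f p' + c * f q = 0" "f p' + d * f q = 0" by (simp_all add: f.add f.scale)
    then have "(d - c) * f q = 0" unfolding left_diff_distrib by linarith
    with cd have "f q = 0" by simp
    with \<open>f p' + c * f q = 0\<close> p' show False by simp
  qed
  then obtain r where r: "a p' p' + 2 * r * a p' q + r\<^sup>2 * a q q = 0" "f (p' + r *\<^sub>R q) \<noteq> 0"
    using cd by blast
  \<comment> \<open>The isotropic vector is not in the radical: orthogonality to \<open>p'\<close>
    and \<open>q\<close> would give \<open>a p' p' = r\<^sup>2 * a q q\<close>, which has the wrong
    sign.\<close>
  have "a (p' + r *\<^sub>R q) q \<noteq> 0 \<or> a (p' + r *\<^sub>R q) p' \<noteq> 0"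
  proof (rule ccontr)
    assume "\<not> ?thesis"
    then have "a p' q + r * a q q = 0" "a p' p' + r * a p' q = 0"
      by (simp_all add: sym_bilinear_simps[OF a] sym_bilinear_commute[OF a, of q p'])
    then have "a p' p' = r\<^sup>2 * a q q" by (simp add: power2_eq_square) algebra
    moreover have "r\<^sup>2 * a q q \<le> 0" using q by (simp add: mult_nonneg_nonpos)
    ultimately show False using p' by simp
  qed
  moreover have "p' + r *\<^sub>R q \<in> V" using p' q V by (simp add: subspace_add subspace_scale)
  moreover have "a (p' + r *\<^sub>R q) (p' + r *\<^sub>R q) = 0" using r by (simp add: sym_bilinear_line[OF a])
  ultimately show ?thesis using r(2) by blast
qed

section \<open>Regular common zeros\<close>

text \<open>For the forms of two symmetric matrices this is membership in \<open>Nset\<close>.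
  Functionals replace the vectors \<open>A *v z\<close> and \<open>B *v z\<close>, so that the
  notion makes sense for an abstract pencil.\<close>

definition regular_zero :: "('a::real_vector \<Rightarrow> 'a \<Rightarrow> real) \<Rightarrow> ('a \<Rightarrow> 'a \<Rightarrow> real) \<Rightarrow> 'a \<Rightarrow> bool" where
  "regular_zero a b z \<longleftrightarrow> a z z = 0 \<and> b z z = 0 \<and>
     (\<forall>s t. (\<forall>y. s * a z y + t * b z y = 0) \<longrightarrow> s = 0 \<and> t = 0)"

text \<open>The factors may be dependent or zero here; for a non-dissipative pair such degenerate
  products are excluded later, since they are semidefinite.\<close>

definition has_product_element :: "('a::real_vector \<Rightarrow> 'a \<Rightarrow> real) \<Rightarrow> ('a \<Rightarrow> 'a \<Rightarrow> real) \<Rightarrow> bool" where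
  "has_product_element a b \<longleftrightarrow> (\<exists>s t f g. (s \<noteq> 0 \<or> t \<noteq> 0) \<and> linear f \<and> linear g \<and>
     (\<forall>w. s * a w w + t * b w w = f w * (g w :: real)))"

lemma regular_zeroI:
  assumes "a z z = 0" "b z z = 0" "a z y = 0" "b z y \<noteq> 0" "a z x \<noteq> 0"
  shows "regular_zero a b z"
  unfolding regular_zero_def
proof (intro conjI allI impI)
  fix s t assume *: "\<forall>y. s * a z y + t * b z y = 0"
  from *[rule_format, of y] assms show "t = 0" by simp
  with *[rule_format, of x] assms show "s = 0" by simp
qed (use assms in auto)

text \<open>Adding a multiple of the radical vector \<open>z\<close> to \<open>w\<close> does not
  change \<open>a\<close> and changes \<open>b w w\<close> by a linear term. Hence a zero
  \<open>w\<close> of \<open>a\<close> off the hyperplane \<open>b z w = 0\<close> can be corrected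
  to a common zero, with \<open>z\<close> as test vector for independence.\<close>

lemma regular_zero_from_radical:
  assumes a: "sym_bilinear a" and b: "sym_bilinear b"
    and p: "a p p > 0" and q: "a q q < 0"
    and z: "\<And>y. a z y = 0" "b z z = 0" "b z e \<noteq> 0"
  shows "\<exists>w. regular_zero a b w"
proof -
  obtain w y where w: "a w w = 0" "b z w \<noteq> 0" "a w y \<noteq> 0"
    using isotropic_off_hyperplane[OF a subspace_UNIV _ p _ q sym_bilinear_linear[OF b] _ z(3)] by auto
  define r where "r = - b w w / (2 * b z w)"
  have zc: "a y z = 0" for y using z(1) sym_bilinear_commute[OF a] by metis
  have "regular_zero a b (w + r *\<^sub>R z)"
  proof (rule regular_zeroI)
    show "a (w + r *\<^sub>R z) (w + r *\<^sub>R z) = 0" "a (w + r *\<^sub>R z) z = 0" "a (w + r *\<^sub>R z) y \<noteq> 0"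
      using w z zc by (simp_all add: sym_bilinear_simps[OF a])
    show "b (w + r *\<^sub>R z) (w + r *\<^sub>R z) = 0"
      using w z unfolding sym_bilinear_line[OF b] by (simp add: r_def sym_bilinear_commute[OF b, of w z])
    show "b (w + r *\<^sub>R z) z \<noteq> 0"
      using w z by (simp add: sym_bilinear_simps[OF b] sym_bilinear_commute[OF b, of w z])
  qed
  then show ?thesis by blast
qed

text \<open>On the plane of \<open>u\<close> and \<open>v\<close> the form \<open>a\<close> vanishes
  and \<open>b\<close> is indefinite and nondegenerate. A zero \<open>z\<close> of \<open>b\<close>
  in this plane is regular unless it lies in the radical of \<open>a\<close>, which is the case of
  the preceding lemma.\<close>

lemma regular_zero_on_isotropic_plane:
  assumes a: "sym_bilinear a" and b: "sym_bilinear b"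
    and p: "a p p > 0" and q: "a q q < 0"
    and uv: "a u u = 0" "a v v = 0" "a u v = 0" "b u u < 0" "b v v > 0"
  shows "\<exists>z. regular_zero a b z"
proof -
  obtain c where c: "b v v + 2 * c * b v u + c\<^sup>2 * b u u = 0"
    using indefinite_quadratic_roots[OF uv(5,4)] by metis
  define z where "z = v + c *\<^sub>R u"
  have az: "a z z = 0" "a z u = 0"
    using uv by (simp_all add: z_def sym_bilinear_line[OF a] sym_bilinear_simps[OF a] sym_bilinear_commute[OF a, of v u])
  have bz: "b z z = 0" using c by (simp add: z_def sym_bilinear_line[OF b])
  have "b z u \<noteq> 0"
  proof
    assume "b z u = 0"
    then have *: "b v u = - c * b u u" by (simp add: z_def sym_bilinear_simps[OF b])
    have "b v v = c\<^sup>2 * b u u" using c unfolding * by (simp add: power2_eq_square)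
    moreover have "c\<^sup>2 * b u u \<le> 0" using uv by (simp add: mult_nonneg_nonpos)
    ultimately show False using uv by simp
  qed
  show ?thesis
  proof (cases "\<forall>y. a z y = 0")
    case True
    then show ?thesis using regular_zero_from_radical[OF a b p q _ bz \<open>b z u \<noteq> 0\<close>] by blast
  next
    case False
    then show ?thesis using regular_zeroI[of a z b u, OF az(1) bz az(2) \<open>b z u \<noteq> 0\<close>] by blast
  qed
qed

section \<open>Pencils containing a form with two positive and two negative squares\<close>

lemma binary_form_factor:
  fixes P R S x y :: real
  assumes "P < 0" "S > 0"
  shows "P * x\<^sup>2 + 2 * R * x * y + S * y\<^sup>2 =
    (x + (R + sqrt (R\<^sup>2 - P * S)) / P * y) * (P * x + (R - sqrt (R\<^sup>2 - P * S)) * y)"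
proof -
  have "P * S < 0" using assms by (simp add: mult_neg_pos)
  then have "0 \<le> R\<^sup>2 - P * S" using zero_le_power2[of R] by linarith
  then have e2: "sqrt (R\<^sup>2 - P * S) * sqrt (R\<^sup>2 - P * S) = R\<^sup>2 - P * S" by simp
  define e where "e = sqrt (R\<^sup>2 - P * S)"
  have "(x + (R + e) / P * y) * (P * x + (R - e) * y)
    = P * x\<^sup>2 + 2 * R * x * y + (R\<^sup>2 - e * e) / P * y\<^sup>2"
    using assms by (simp add: field_simps power2_eq_square)
  also have "(R\<^sup>2 - e * e) / P = S" using e2 assms unfolding e_def by simp
  finally show ?thesis unfolding e_def by simp
qed

text \<open>The Gram determinant condition makes \<open>a\<close> positive definite on the plane of
  \<open>p\<close> and \<open>q\<close>, and a hyperplane meets every plane nontrivially.\<close>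

lemma positive_plane_meets_hyperplane:
  assumes a: "sym_bilinear a" and p: "a p p > 0" "a p p * a q q - (a p q)\<^sup>2 > 0"
    and f: "linear f"
  shows "\<exists>w. a w w > 0 \<and> f w = (0::real)"
proof -
  interpret f: linear f by fact
  show ?thesis
  proof (cases "f p = 0")
    case True then show ?thesis using p by blast
  next
    case False
    define c where "c = - f q / f p"
    have "a p p * a (q + c *\<^sub>R p) (q + c *\<^sub>R p) = (a p q + c * a p p)\<^sup>2 + (a p p * a q q - (a p q)\<^sup>2)"
      by (simp add: sym_bilinear_line[OF a] sym_bilinear_commute[OF a, of q p] power2_eq_square algebra_simps)
    also have "\<dots> > 0" using p by (simp add: add_nonneg_pos)
    finally have "a (q + c *\<^sub>R p) (q + c *\<^sub>R p) > 0" using p by (simp add: zero_less_mult_iff)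
    moreover have "f (q + c *\<^sub>R p) = 0" using False unfolding f.add f.scale by (simp add: c_def)
    ultimately show ?thesis by blast
  qed
qed

text \<open>The component of \<open>w\<close> in the hyperbolic plane of \<open>u\<close> and
  \<open>v\<close> has value \<open>2 * a u w * a v w / a u v\<close>. Choosing a positive
  \<open>w\<close> in a hyperplane on which this is nonpositive makes its projection to the
  complement positive as well.\<close>

lemma positive_on_hyperbolic_complement:
  assumes a: "sym_bilinear a" and p: "a p p > 0" "a p p * a q q - (a p q)\<^sup>2 > 0"
    and uv: "a u u = 0" "a v v = 0" "a u v \<noteq> 0"
  shows "\<exists>y. a u y = 0 \<and> a v y = 0 \<and> a y y > 0"
proof -
  have lin: "linear (\<lambda>w. a v w + sgn (a u v) * a u w)"
    by (intro linear_compose_add linear_compose_scale_right[of "a u", simplified] sym_bilinear_linear[OF a])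
  obtain w where w: "a w w > 0" "a v w + sgn (a u v) * a u w = 0"
    using positive_plane_meets_hyperplane[OF a p lin] by blast
  define k where "k = a u v"
  have k: "k \<noteq> 0" "a v u = k" "a u v = k" using uv sym_bilinear_commute[OF a, of v u] by (auto simp: k_def)
  define y where "y = w - (a v w / k) *\<^sub>R u - (a u w / k) *\<^sub>R v"
  have uy: "a u y = 0" "a v y = 0"
    using uv k by (simp_all add: y_def sym_bilinear_simps[OF a])
  have "a y y = a y w"
    using uy unfolding y_def[THEN arg_cong, of "a y"]
    by (simp add: sym_bilinear_simps[OF a] sym_bilinear_commute[OF a, of y])
  also have "\<dots> = a w w - 2 * a u w * a v w / k"
    by (simp add: y_def sym_bilinear_simps[OF a])
  also have "a v w = - sgn k * a u w" using w by (simp add: k_def)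
  also have "a w w - 2 * a u w * (- sgn k * a u w) / k = a w w + 2 * (a u w)\<^sup>2 / \<bar>k\<bar>"
    using k by (simp add: sgn_if power2_eq_square)
  finally have "a y y > 0" using w k by (simp add: add_pos_nonneg)
  then show ?thesis using uy by blast
qed

text \<open>Without regular zeros, zeros \<open>u\<close> and \<open>v\<close> of \<open>a\<close>
  with opposite signs of \<open>b\<close> span a hyperbolic plane for \<open>a\<close>. On the
  complement \<open>Y\<close> the form \<open>a\<close> is still indefinite, and every zero of
  \<open>a\<close> there is forced to be a zero of \<open>b\<close>. Some \<open>b - m * a\<close>
  then lives on the plane of \<open>u\<close> and \<open>v\<close>, where it is an indefinite binary
  form.\<close>

lemma regular_zero_or_product_aux:
  assumes a: "sym_bilinear a" and b: "sym_bilinear b"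
    and nd: "\<And>s t. (\<And>z. s * a z z + t * b z z \<ge> 0) \<Longrightarrow> s = 0 \<and> t = 0"
    and p: "a p p > 0" "a p p * a p' p' - (a p p')\<^sup>2 > 0"
    and q: "a q q < 0" "a q q * a q' q' - (a q q')\<^sup>2 > 0"
  shows "(\<exists>z. regular_zero a b z) \<or> has_product_element a b"
proof (cases "\<exists>z. regular_zero a b z")
  case nreg: False
  have am: "sym_bilinear (\<lambda>x y. - a x y)" and bm: "sym_bilinear (\<lambda>x y. - b x y)"
    using sym_bilinear_combination[OF a a, of "-1" 0] sym_bilinear_combination[OF b b, of "-1" 0]
    by simp_all
  \<comment> \<open>Otherwise the S-lemma would produce a semidefinite combination of
    \<open>a\<close> and \<open>b\<close>; likewise for \<open>v\<close>.\<close>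
  obtain u where u: "a u u = 0" "b u u < 0"
  proof (rule ccontr)
    assume "\<not> thesis"
    then have "\<And>x. a x x = 0 \<Longrightarrow> b x x \<ge> 0" using that by force
    then obtain t where "\<forall>x. b x x + t * a x x \<ge> 0"
      using s_lemma[OF a b subspace_UNIV _ p(1) _ q(1)] by auto
    then show False using nd[of t 1] by (auto simp: algebra_simps)
  qed
  obtain v where v: "a v v = 0" "b v v > 0"
  proof (rule ccontr)
    assume "\<not> thesis"
    then have "\<And>x. a x x = 0 \<Longrightarrow> - b x x \<ge> 0" using that by force
    then obtain t where "\<forall>x. - b x x + t * a x x \<ge> 0"
      using s_lemma[OF a bm subspace_UNIV _ p(1) _ q(1)] by auto
    then show False using nd[of t "-1"] by (auto simp: algebra_simps)
  qed
  define k where "k = a u v"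
  have kne: "k \<noteq> 0"
    using regular_zero_on_isotropic_plane[OF a b p(1) q(1) u(1) v(1) _ u(2) v(2)] nreg by (auto simp: k_def)
  have k: "a u v = k" "a v u = k" using sym_bilinear_commute[OF a] by (auto simp: k_def)
  define Y where "Y = {y. a u y = 0 \<and> a v y = 0}"
  have Y: "subspace Y" unfolding Y_def subspace_def by (auto simp: sym_bilinear_simps[OF a])
  obtain y1 where y1: "y1 \<in> Y" "a y1 y1 > 0"
    using positive_on_hyperbolic_complement[OF a p u(1) v(1)] kne k by (auto simp: Y_def)
  obtain y2 where y2: "y2 \<in> Y" "a y2 y2 < 0"
    using positive_on_hyperbolic_complement[OF am, of q q' u v] kne k q u v by (auto simp: Y_def)
  have iso: "b w w = 0 \<and> b u w = 0 \<and> b v w = 0" if w: "w \<in> Y" "a w w = 0" for w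
  proof -
    have uw: "a u w = 0" "a w v = 0" "a w u = 0"
      using w sym_bilinear_commute[OF a] by (auto simp: Y_def)
    have bww: "b w w = 0"
    proof (rule ccontr)
      \<comment> \<open>\<open>a\<close> vanishes on the planes of \<open>u, w\<close> and of
        \<open>w, v\<close>; one of them has both signs of \<open>b\<close>, according to the sign
        of \<open>b w w\<close>.\<close>
      assume "b w w \<noteq> 0"
      then consider "b w w > 0" | "b w w < 0" by linarith
      then show False
        using regular_zero_on_isotropic_plane[OF a b p(1) q(1) u(1) w(2) uw(1) u(2)]
          regular_zero_on_isotropic_plane[OF a b p(1) q(1) w(2) v(1) uw(2) _ v(2)] nreg
        by cases blast+
    qed
    \<comment> \<open>If \<open>w\<close> is outside the radical of \<open>a\<close>, then
      \<open>x\<close> would witness that \<open>w\<close> is regular; if inside, the radical lemma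
      would give a regular zero.\<close>
    have bw: "b w x = 0" if "a w x = 0" for x
    proof (rule ccontr)
      assume "b w x \<noteq> 0"
      then show False
        using regular_zeroI[of a w b x, OF w(2) bww that] regular_zero_from_radical[OF a b p(1) q(1) _ bww] nreg
        by blast
    qed
    show ?thesis
      using bww bw[OF uw(2)] bw[OF uw(3)] sym_bilinear_commute[OF b] by metis
  qed
  obtain m where m: "\<forall>y\<in>Y. b y y = m * a y y"
    using proportional_on_isotropic_cone[OF a b Y y1 y2] iso by blast
  \<comment> \<open>A functional \<open>b u\<close> or \<open>b v\<close> that is nonzero on
    \<open>Y\<close> would be nonzero at some zero of \<open>a\<close> in \<open>Y\<close>, against
    \<open>iso\<close>.\<close>
  have buy: "b u y = 0" "b v y = 0" if "y \<in> Y" for y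
    using isotropic_off_hyperplane[OF a Y y1 y2 sym_bilinear_linear[OF b] that] iso by blast+
  define R where "R = b u v - m * k"
  \<comment> \<open>These are the coordinates of \<open>w\<close> along \<open>u\<close> and
    \<open>v\<close> modulo \<open>Y\<close>. Since \<open>a u u = a v v = 0\<close>, only the mixed
    coefficient \<open>R\<close> of \<open>b - m * a\<close> differs from that of
    \<open>b\<close>.\<close>
  define \<alpha> \<beta> where "\<alpha> w = a v w / k" and "\<beta> w = a u w / k" for w
  have lin: "linear \<alpha>" "linear \<beta>"
    unfolding \<alpha>_def \<beta>_def
    by (auto simp: linear_iff sym_bilinear_simps[OF a] add_divide_distrib)
  have eq: "- m * a w w + 1 * b w w = b u u * (\<alpha> w)\<^sup>2 + 2 * R * \<alpha> w * \<beta> w + b v v * (\<beta> w)\<^sup>2" for w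
  proof -
    define y where "y = w - \<alpha> w *\<^sub>R u - \<beta> w *\<^sub>R v"
    have y: "y \<in> Y"
      using u v kne k by (simp add: y_def Y_def \<alpha>_def \<beta>_def sym_bilinear_simps[OF a])
    have w: "w = \<alpha> w *\<^sub>R u + \<beta> w *\<^sub>R v + y" by (simp add: y_def)
    have ay: "a u y = 0" "a y u = 0" "a v y = 0" "a y v = 0" using y sym_bilinear_commute[OF a] by (auto simp: Y_def)
    have bys: "b u y = 0" "b y u = 0" "b v y = 0" "b y v = 0" using buy[OF y] sym_bilinear_commute[OF b] by auto
    have "a w w = 2 * \<alpha> w * \<beta> w * k + a y y"
      by (subst (1 2) w) (simp add: sym_bilinear_simps[OF a] ay u v k)
    moreover have "b w w = b u u * (\<alpha> w)\<^sup>2 + 2 * \<alpha> w * \<beta> w * b u v + b v v * (\<beta> w)\<^sup>2 + b y y"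
      by (subst (1 2) w) (simp add: sym_bilinear_simps[OF b] bys sym_bilinear_commute[OF b, of v u]
          power2_eq_square algebra_simps)
    ultimately show ?thesis using m y by (simp add: R_def algebra_simps)
  qed
  have "has_product_element a b"
    unfolding has_product_element_def
  proof (intro exI conjI allI)
    let ?e = "sqrt (R\<^sup>2 - b u u * b v v)"
    show "- m \<noteq> 0 \<or> (1::real) \<noteq> 0" by simp
    show "linear (\<lambda>w. \<alpha> w + (R + ?e) / b u u * \<beta> w)" "linear (\<lambda>w. b u u * \<alpha> w + (R - ?e) * \<beta> w)"
      using linear_real_combination[OF lin, of 1 "(R + ?e) / b u u"]
        linear_real_combination[OF lin, of "b u u" "R - ?e"] by simp_all
    show "- m * a w w + 1 * b w w = (\<alpha> w + (R + ?e) / b u u * \<beta> w) * (b u u * \<alpha> w + (R - ?e) * \<beta> w)" for w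
      unfolding eq by (rule binary_form_factor[OF u(2) v(2)])
  qed
  then show ?thesis ..
qed blast

section \<open>The circle of forms in the pencil\<close>

lemma rotated_pencil_inverse:
  fixes c s x y :: real
  assumes "c\<^sup>2 + s\<^sup>2 = 1"
  shows "c * (c * x + s * y) - s * (c * y - s * x) = x" "s * (c * x + s * y) + c * (c * y - s * x) = y"
proof -
  have "c * (c * x + s * y) - s * (c * y - s * x) = (c\<^sup>2 + s\<^sup>2) * x"
    "s * (c * x + s * y) + c * (c * y - s * x) = (c\<^sup>2 + s\<^sup>2) * y"
    by (simp_all add: algebra_simps power2_eq_square)
  then show "c * (c * x + s * y) - s * (c * y - s * x) = x" "s * (c * x + s * y) + c * (c * y - s * x) = y"
    using assms by simp_all
qed

text \<open>The conditions \<open>pos\<close> and \<open>neg\<close> forbid definite planes. For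
  orthogonal \<open>u\<close> and \<open>v\<close> of opposite signs, a vector orthogonal to both
  must therefore have value zero, so \<open>m\<close> is a difference of two squares.\<close>

lemma product_of_hyperbolic_form:
  assumes m: "sym_bilinear m" and u: "m u u > 0" and q: "m q q < 0"
    and pos: "\<And>x y. m x x > 0 \<Longrightarrow> m x x * m y y \<le> (m x y)\<^sup>2"
    and neg: "\<And>x y. m x x < 0 \<Longrightarrow> m x x * m y y \<le> (m x y)\<^sup>2"
  shows "\<exists>f g. linear f \<and> linear g \<and> (\<forall>w. m w w = f w * (g w :: real))"
proof -
  define v where "v = q + (- m u q / m u u) *\<^sub>R u"
  have uv: "m u v = 0" "m v u = 0"
    using u sym_bilinear_commute[OF m, of v u] by (simp_all add: v_def sym_bilinear_simps[OF m])
  have "m v v = m q q - (m u q)\<^sup>2 / m u u"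
    using u unfolding v_def sym_bilinear_line[OF m]
    by (simp add: sym_bilinear_commute[OF m, of q u] power2_eq_square field_simps)
  moreover have "(m u q)\<^sup>2 / m u u \<ge> 0" using u by simp
  ultimately have v: "m v v < 0" using q by linarith
  have zero: "m y y = 0" if "m u y = 0" "m v y = 0" for y
    using pos[OF u, of y] neg[OF v, of y] that u v by (auto simp: mult_le_0_iff)
  have eq: "m w w = (m u w)\<^sup>2 / m u u + (m v w)\<^sup>2 / m v v" for w
  proof -
    define y where "y = w - (m u w / m u u) *\<^sub>R u - (m v w / m v v) *\<^sub>R v"
    have uy: "m u y = 0" "m v y = 0"
      using u v uv by (simp_all add: y_def sym_bilinear_simps[OF m])
    have "0 = m y y" using zero[OF uy] by simp
    also have "\<dots> = m y w"
      using uy unfolding y_def[THEN arg_cong, of "m y"]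
      by (simp add: sym_bilinear_simps[OF m] sym_bilinear_commute[OF m, of y])
    also have "\<dots> = m w w - (m u w)\<^sup>2 / m u u - (m v w)\<^sup>2 / m v v"
      by (simp add: y_def sym_bilinear_simps[OF m] power2_eq_square)
    finally show ?thesis by simp
  qed
  define \<alpha> \<beta> where "\<alpha> w = m u w / sqrt (m u u)" and "\<beta> w = m v w / sqrt (- m v v)" for w
  have "linear (\<lambda>w. \<alpha> w - \<beta> w)" "linear (\<lambda>w. \<alpha> w + \<beta> w)"
    unfolding \<alpha>_def \<beta>_def linear_iff
    by (auto simp: sym_bilinear_simps[OF m] add_divide_distrib diff_divide_distrib algebra_simps)
  moreover have "m w w = (\<alpha> w - \<beta> w) * (\<alpha> w + \<beta> w)" for w
  proof -
    have "(\<alpha> w)\<^sup>2 = (m u w)\<^sup>2 / m u u" "(\<beta> w)\<^sup>2 = - ((m v w)\<^sup>2 / m v v)"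
      using u v by (simp_all add: \<alpha>_def \<beta>_def power_divide)
    then show ?thesis using eq[of w] by (simp add: algebra_simps power2_eq_square)
  qed
  ultimately show ?thesis by blast
qed

text \<open>Going from a form of the pencil to its negative along the circle, either some form has two positive
  and two negative squares, or some nonzero form has at most one of each.\<close>

proposition regular_zero_or_product:
  assumes a: "sym_bilinear a" and b: "sym_bilinear b"
    and nd: "\<And>s t. (\<And>z. s * a z z + t * b z z \<ge> 0) \<Longrightarrow> s = 0 \<and> t = 0"
  shows "(\<exists>z. regular_zero a b z) \<or> has_product_element a b"
proof -
  define m where "m \<theta> x y = cos \<theta> * a x y + sin \<theta> * b x y" for \<theta> x y
  have sbm: "sym_bilinear (m \<theta>)" for \<theta>
    unfolding m_def using sym_bilinear_combination[OF a b] .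
  \<comment> \<open>\<open>P\<close> and \<open>N\<close> are the angles whose form is positive,
    respectively negative, definite on some plane, expressed by Gram determinants.\<close>
  define P N where "P = {\<theta>. \<exists>u v. m \<theta> u u > 0 \<and> m \<theta> u u * m \<theta> v v - (m \<theta> u v)\<^sup>2 > 0}"
    and "N = {\<theta>. \<exists>u v. m \<theta> u u < 0 \<and> m \<theta> u u * m \<theta> v v - (m \<theta> u v)\<^sup>2 > 0}"
  consider (both) \<theta> where "\<theta> \<in> P" "\<theta> \<in> N" | (neither) \<theta> where "\<theta> \<notin> P" "\<theta> \<notin> N"
    | (cover) "P \<union> N = UNIV" "P \<inter> N = {}" by blast
  then show ?thesis
  proof cases
    case both
    define c s where "c = cos \<theta>" and "s = sin \<theta>"
    have cs: "c\<^sup>2 + s\<^sup>2 = 1" by (simp add: c_def s_def)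
    \<comment> \<open>\<open>m \<theta>\<close> and \<open>b'\<close> arise from \<open>a\<close>
      and \<open>b\<close> by a rotation, so regular zeros and product elements carry over between
      the two pairs.\<close>
    define b' where "b' x y = c * b x y - s * a x y" for x y
    have ab: "c * m \<theta> x y - s * b' x y = a x y" "s * m \<theta> x y + c * b' x y = b x y" for x y
      using rotated_pencil_inverse[OF cs] by (simp_all add: m_def b'_def c_def s_def)
    have b': "sym_bilinear b'"
      using sym_bilinear_combination[OF b a, of c "-s"] by (simp add: b'_def[abs_def])
    have conv: "x * m \<theta> z y + t * b' z y = (x * c - t * s) * a z y + (x * s + t * c) * b z y" for x t z y
      by (simp add: m_def b'_def c_def s_def algebra_simps)
    have inj: "x = 0 \<and> t = 0" if "x * c - t * s = 0" "x * s + t * c = 0" for x t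
    proof -
      have "(c\<^sup>2 + s\<^sup>2) * x = c * (x * c - t * s) + s * (x * s + t * c)"
        "(c\<^sup>2 + s\<^sup>2) * t = c * (x * s + t * c) - s * (x * c - t * s)"
        by (simp_all add: algebra_simps power2_eq_square)
      then show ?thesis unfolding that cs by simp
    qed
    have nd': "x = 0 \<and> t = 0" if "\<And>z. x * m \<theta> z z + t * b' z z \<ge> 0" for x t
    proof -
      have "x * c - t * s = 0 \<and> x * s + t * c = 0"
        by (rule nd) (use that in \<open>simp add: conv\<close>)
      then show ?thesis using inj[of x t] by simp
    qed
    obtain p p' q q' where "m \<theta> p p > 0" "m \<theta> p p * m \<theta> p' p' - (m \<theta> p p')\<^sup>2 > 0"
      "m \<theta> q q < 0" "m \<theta> q q * m \<theta> q' q' - (m \<theta> q q')\<^sup>2 > 0"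
      using both unfolding P_def N_def by blast
    from regular_zero_or_product_aux[OF sbm b' nd' this]
    show ?thesis
    proof
      assume "\<exists>z. regular_zero (m \<theta>) b' z"
      then obtain z where z: "regular_zero (m \<theta>) b' z" ..
      have "regular_zero a b z"
        unfolding regular_zero_def
      proof (intro conjI)
        have "m \<theta> z z = 0" "b' z z = 0" using z unfolding regular_zero_def by blast+
        then show "a z z = 0" "b z z = 0" using ab[of z z] by simp_all
        show "\<forall>x t. (\<forall>y. x * a z y + t * b z y = 0) \<longrightarrow> x = 0 \<and> t = 0"
        proof (intro allI impI)
          fix x t assume *: "\<forall>y. x * a z y + t * b z y = 0"
          have "(x * c + t * s) * m \<theta> z y + (t * c - x * s) * b' z y = x * a z y + t * b z y" for y
            by (simp add: ab[symmetric] algebra_simps)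
          then have "\<forall>y. (x * c + t * s) * m \<theta> z y + (t * c - x * s) * b' z y = 0"
            using * by simp
          then have "x * c + t * s = 0 \<and> t * c - x * s = 0"
            using z unfolding regular_zero_def by blast
          then show "x = 0 \<and> t = 0" using inj[of t x] by (simp add: algebra_simps)
        qed
      qed
      then show ?thesis by blast
    next
      assume "has_product_element (m \<theta>) b'"
      then obtain x t f g where fg: "x \<noteq> 0 \<or> t \<noteq> 0" "linear f" "linear g"
        "\<And>w. x * m \<theta> w w + t * b' w w = f w * g w"
        unfolding has_product_element_def by blast
      then have "x * c - t * s \<noteq> 0 \<or> x * s + t * c \<noteq> 0" using inj by blast
      then have "has_product_element a b"
        unfolding has_product_element_def
        by (intro exI[of _ "x * c - t * s"] exI[of _ "x * s + t * c"] exI[of _ f] exI[of _ g])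
          (use fg in \<open>simp add: conv[symmetric]\<close>)
      then show ?thesis ..
    qed
  next
    case neither
    have "cos \<theta> \<noteq> 0 \<or> sin \<theta> \<noteq> 0" using sin_cos_squared_add[of \<theta>] by fastforce
    then have "\<not> (\<forall>z. m \<theta> z z \<ge> 0)" "\<not> (\<forall>z. - m \<theta> z z \<ge> 0)"
      using nd[of "cos \<theta>" "sin \<theta>"] nd[of "- cos \<theta>" "- sin \<theta>"] by (auto simp: m_def)
    then obtain u q where uq: "m \<theta> u u > 0" "m \<theta> q q < 0" by (meson neg_0_le_iff_le not_le)
    have "m \<theta> x x * m \<theta> y y \<le> (m \<theta> x y)\<^sup>2" if "m \<theta> x x > 0" for x y
    proof (rule ccontr)
      assume "\<not> ?thesis"
      with that have "\<theta> \<in> P" unfolding P_def by (intro CollectI exI[of _ x] exI[of _ y]) simp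
      with neither show False by simp
    qed
    moreover have "m \<theta> x x * m \<theta> y y \<le> (m \<theta> x y)\<^sup>2" if "m \<theta> x x < 0" for x y
    proof (rule ccontr)
      assume "\<not> ?thesis"
      with that have "\<theta> \<in> N" unfolding N_def by (intro CollectI exI[of _ x] exI[of _ y]) simp
      with neither show False by simp
    qed
    ultimately have "\<exists>f g. linear f \<and> linear g \<and> (\<forall>w. m \<theta> w w = f w * g w)"
      by (rule product_of_hyperbolic_form[OF sbm uq])
    then obtain f g where "linear f" "linear g" "\<forall>w. m \<theta> w w = f w * g w" by blast
    then have "has_product_element a b"
      unfolding has_product_element_def
      by (intro exI[of _ "cos \<theta>"] exI[of _ "sin \<theta>"] exI[of _ f] exI[of _ g])
        (use \<open>cos \<theta> \<noteq> 0 \<or> sin \<theta> \<noteq> 0\<close> in \<open>simp add: m_def\<close>)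
    then show ?thesis ..
  next
    case cover
    \<comment> \<open>\<open>P\<close> and \<open>N\<close> are open and are exchanged by the shift
      by \<open>pi\<close>, so both are nonempty. A disjoint cover of the line by them contradicts
      connectedness.\<close>
    have "open P"
      unfolding P_def m_def by (intro open_Collect_ex open_Collect_conj open_Collect_less continuous_intros)
    moreover have "open N"
      unfolding N_def m_def by (intro open_Collect_ex open_Collect_conj open_Collect_less continuous_intros)
    moreover have flip: "m (\<theta> + pi) x y = - m \<theta> x y" for \<theta> x y by (simp add: m_def)
    have PN: "\<theta> + pi \<in> N \<longleftrightarrow> \<theta> \<in> P" "\<theta> + pi \<in> P \<longleftrightarrow> \<theta> \<in> N" for \<theta>
      by (simp_all add: P_def N_def flip)
    have "0 \<in> P \<union> N" using cover by simp
    then have "P \<noteq> {}" "N \<noteq> {}" using PN by blast+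
    ultimately show ?thesis
      using connectedD[of UNIV P N] cover by auto
  qed
qed

section \<open>Components of the regular zero set\<close>

definition mform :: "'d::finite smat \<Rightarrow> 'd phase \<Rightarrow> 'd phase \<Rightarrow> real" where
  "mform M x y = x \<bullet> (M *v y)"

lemma mform_sym_bilinear: "symmetric_mat M \<Longrightarrow> sym_bilinear (mform M)"
  unfolding sym_bilinear_def bilinear_def mform_def linear_iff symmetric_mat_def
  by (auto simp: inner_add_left inner_add_right matrix_vector_right_distrib matrix_vector_mult_scaleR)
    (metis dot_lmul_matrix inner_commute vector_transpose_matrix)

lemma mform_swap: "symmetric_mat M \<Longrightarrow> x \<bullet> (M *v y) = (M *v x) \<bullet> y"
  using sym_bilinear_commute[OF mform_sym_bilinear] by (metis inner_commute mform_def)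

lemma Qf_mform: "Qf M z = mform M z z"
  by (simp add: Qf_def mform_def)

lemma matrix_combination_vec: "(s *\<^sub>R A + t *\<^sub>R B) *v x = s *\<^sub>R (A *v x) + t *\<^sub>R (B *v (x :: real ^ 'n))"
  for A B :: "real ^ 'n ^ 'm"
  by (simp add: matrix_vector_mult_add_rdistrib scaleR_matrix_vector_assoc)

lemma mform_combination: "mform (s *\<^sub>R A + t *\<^sub>R B) x y = s * mform A x y + t * mform B x y"
  by (simp add: mform_def matrix_combination_vec inner_add_right)

lemma Qf_combination: "Qf (s *\<^sub>R A + t *\<^sub>R B) z = s * Qf A z + t * Qf B z"
  by (simp add: Qf_mform mform_combination)

lemma symmetric_mat_combination:
  "symmetric_mat A \<Longrightarrow> symmetric_mat B \<Longrightarrow> symmetric_mat (s *\<^sub>R A + t *\<^sub>R B)"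
  unfolding symmetric_mat_def transpose_def by (simp add: vec_eq_iff)

section \<open>Independent gradients and curves in the regular zero set\<close>

lemma lin_indep2_dual_vector:
  fixes u v :: "'a::real_inner"
  assumes "lin_indep2 u v"
  obtains a where "u \<bullet> a = 1" "v \<bullet> a = 0"
proof -
  have v: "v \<noteq> 0" using assms unfolding lin_indep2_def by (metis add.right_neutral one_neq_zero scaleR_zero_left scaleR_zero_right add_0)
  define p where "p = u - ((u \<bullet> v) / (v \<bullet> v)) *\<^sub>R v"
  have "p \<noteq> 0"
  proof
    assume "p = 0"
    then have "1 *\<^sub>R u + (- ((u \<bullet> v) / (v \<bullet> v))) *\<^sub>R v = 0" by (simp add: p_def)
    then show False using assms unfolding lin_indep2_def by (metis one_neq_zero)
  qed
  have vp: "v \<bullet> p = 0" using v by (simp add: p_def inner_diff_right inner_commute)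
  have "u = p + ((u \<bullet> v) / (v \<bullet> v)) *\<^sub>R v" by (simp add: p_def)
  then have "u \<bullet> p = p \<bullet> p" by (metis add.right_neutral inner_add_left inner_scaleR_left mult_zero_right vp)
  then show ?thesis
    using \<open>p \<noteq> 0\<close> vp that[of "(1 / (p \<bullet> p)) *\<^sub>R p"] by simp
qed

lemma lin_indep2_commute: "lin_indep2 u v \<longleftrightarrow> lin_indep2 v u"
  unfolding lin_indep2_def by (metis add.commute)

text \<open>Cramer's rule: a nonzero two-by-two minor certifies independence. Unlike independence
  itself, the minor is directly a continuous function of the base point.\<close>

lemma lin_indep2I_det:
  fixes u v a b :: "'a::real_inner"
  assumes "(u \<bullet> a) * (v \<bullet> b) - (u \<bullet> b) * (v \<bullet> a) \<noteq> 0"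
  shows "lin_indep2 u v"
  unfolding lin_indep2_def
proof (intro allI impI)
  fix s t assume *: "s *\<^sub>R u + t *\<^sub>R v = 0"
  have 1: "s * (u \<bullet> a) + t * (v \<bullet> a) = 0" "s * (u \<bullet> b) + t * (v \<bullet> b) = 0"
    using arg_cong[OF *, of "\<lambda>x. x \<bullet> a"] arg_cong[OF *, of "\<lambda>x. x \<bullet> b"] by (simp_all add: inner_add_left)
  have "s * ((u \<bullet> a) * (v \<bullet> b) - (u \<bullet> b) * (v \<bullet> a)) = (v \<bullet> b) * (s * (u \<bullet> a) + t * (v \<bullet> a)) - (v \<bullet> a) * (s * (u \<bullet> b) + t * (v \<bullet> b))"
    "t * ((u \<bullet> a) * (v \<bullet> b) - (u \<bullet> b) * (v \<bullet> a)) = (u \<bullet> a) * (s * (u \<bullet> b) + t * (v \<bullet> b)) - (u \<bullet> b) * (s * (u \<bullet> a) + t * (v \<bullet> a))"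
    by (simp_all add: algebra_simps)
  then show "s = 0 \<and> t = 0" unfolding 1 using assms by simp
qed

lemma has_derivative_half_Qf:
  assumes M: "symmetric_mat M"
  shows "((\<lambda>y. (y \<bullet> (M *v y)) / 2) has_derivative (\<lambda>h. (M *v y) \<bullet> h)) (at y)"
proof -
  have "((\<lambda>y. (y \<bullet> (M *v y)) / 2) has_derivative (\<lambda>h. (y \<bullet> (M *v h) + h \<bullet> (M *v y)) / 2)) (at y)"
    by (auto intro!: derivative_eq_intros matrix_vector_mul_bounded_linear bounded_linear_imp_has_derivative)
  then show ?thesis by (simp add: mform_swap[OF M, of y] inner_commute)
qed

text \<open>The inverse function theorem yields, for every tangent vector, a curve in the regular zero set
  with that velocity.\<close>

lemma tangent_vector_in_span:
  fixes A B :: "'d::finite smat"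
  assumes A: "symmetric_mat A" and B: "symmetric_mat B"
    and z: "z \<in> Nset A B" and U: "open U" "z \<in> U"
    and w: "w \<bullet> (A *v z) = 0" "w \<bullet> (B *v z) = 0"
  shows "w \<in> span (connected_component_set (Nset A B) z \<inter> U)"
proof -
  define \<alpha> \<beta> where "\<alpha> = A *v z" and "\<beta> = B *v z"
  have ind: "lin_indep2 \<alpha> \<beta>" and zz: "z \<bullet> (A *v z) = 0" "z \<bullet> (B *v z) = 0"
    using z by (auto simp: Nset_def \<alpha>_def \<beta>_def Qf_def)
  obtain a where a: "\<alpha> \<bullet> a = 1" "\<beta> \<bullet> a = 0" using lin_indep2_dual_vector[OF ind] .
  obtain b where b: "\<beta> \<bullet> b = 1" "\<alpha> \<bullet> b = 0"
    using lin_indep2_dual_vector ind lin_indep2_commute by metis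
  have linA [simp]: "bounded_linear ((*v) A)" "bounded_linear ((*v) B)"
    by (simp_all add: matrix_vector_mul_bounded_linear)
  \<comment> \<open>\<open>\<Phi>\<close> straightens the zero set: since \<open>a\<close> and
    \<open>b\<close> are dual to \<open>\<alpha>\<close> and \<open>\<beta>\<close>, the values
    \<open>\<alpha> \<bullet> \<Phi> y\<close> and \<open>\<beta> \<bullet> \<Phi> y\<close> are
    half of \<open>Qf A y\<close> and \<open>Qf B y\<close>. Its derivative \<open>F z\<close> at
    \<open>z\<close> is the identity.\<close>
  define \<Phi> where "\<Phi> y = y + ((y \<bullet> (A *v y)) / 2 - \<alpha> \<bullet> y) *\<^sub>R a + ((y \<bullet> (B *v y)) / 2 - \<beta> \<bullet> y) *\<^sub>R b" for y
  define F where "F y h = h + ((A *v y) \<bullet> h - \<alpha> \<bullet> h) *\<^sub>R a + ((B *v y) \<bullet> h - \<beta> \<bullet> h) *\<^sub>R b" for y h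
  have "linear (F y)" for y
    unfolding F_def by (auto simp: linear_iff algebra_simps)
  then have blF: "bounded_linear (F y)" for y by (simp add: linear_conv_bounded_linear)
  have der: "(\<Phi> has_derivative blinfun_apply (Blinfun (F y))) (at y)" for y
    unfolding bounded_linear_Blinfun_apply[OF blF] \<Phi>_def F_def
    by (intro has_derivative_add has_derivative_diff has_derivative_scaleR_left has_derivative_ident
        has_derivative_inner_right has_derivative_half_Qf A B)
  have cont: "continuous_on UNIV (\<lambda>y. Blinfun (F y))"
  proof (rule continuous_on_blinfun_componentwise)
    fix i :: "'d phase"
    show "continuous_on UNIV (\<lambda>y. blinfun_apply (Blinfun (F y)) i)"
      unfolding bounded_linear_Blinfun_apply[OF blF] F_def
      by (intro continuous_intros linear_continuous_on linA)
  qed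
  have "F z = id" by (auto simp: F_def \<alpha>_def \<beta>_def)
  then have "Blinfun (F z) = id_blinfun"
    by (metis blF blinfun_apply_id_blinfun bounded_linear_Blinfun_apply blinfun_eqI id_apply)
  then have "id_blinfun o\<^sub>L Blinfun (F z) = id_blinfun" by (simp add: blinfun_eqI)
  from inverse_function_theorem[OF open_UNIV der cont UNIV_I this]
  obtain U' V g g' where UV: "open U'" "z \<in> U'" "open V" "\<Phi> z \<in> V" "homeomorphism U' V \<Phi> g"
    and g': "\<And>y. y \<in> V \<Longrightarrow> (g has_derivative (g' y)) (at y)"
    "\<And>y. y \<in> V \<Longrightarrow> g' y = inv (blinfun_apply (Blinfun (F (g y))))"
    by metis
  have \<Phi>z: "\<Phi> z = z" using zz by (simp add: \<Phi>_def \<alpha>_def \<beta>_def inner_commute)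
  have gz: "g z = z" using UV \<Phi>z by (metis homeomorphism_apply1)
  have zV: "z \<in> V" using UV \<Phi>z by simp
  have "g' z = id"
    unfolding g'(2)[OF zV] gz trans[OF bounded_linear_Blinfun_apply[OF blF] \<open>F z = id\<close>] by simp
  then have derg: "(g has_derivative id) (at z)" using g'(1)[OF zV] by simp
  have contg: "continuous_on V g" using UV by (simp add: homeomorphism_def)
  \<comment> \<open>This minor equals 1 at \<open>z\<close> and stays nonzero on \<open>O'\<close>,
    which keeps the gradients independent along the curve.\<close>
  define D where "D y = ((A *v y) \<bullet> a) * ((B *v y) \<bullet> b) - ((A *v y) \<bullet> b) * ((B *v y) \<bullet> a)" for y
  have contD: "continuous_on UNIV D"
    unfolding D_def by (intro continuous_intros linear_continuous_on linA)
  define O' where "O' = {y. D y \<noteq> 0} \<inter> U"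
  have "open O'" unfolding O'_def using U contD
    by (intro open_Int open_Collect_neq) auto
  have "z \<in> O'" using a b U by (simp add: O'_def D_def \<alpha>_def \<beta>_def)
  define G where "G = (\<lambda>t. z + t *\<^sub>R w) -` (V \<inter> g -` O')"
  have "open (V \<inter> g -` O')"
    using contg \<open>open O'\<close> UV by (simp add: continuous_on_open_vimage Int_commute)
  then have "open G" unfolding G_def
    by (rule open_vimage) (intro continuous_intros)
  moreover have "(0::real) \<in> G" using zV gz \<open>z \<in> O'\<close> by (simp add: G_def)
  ultimately obtain e where e: "e > 0" "cball 0 e \<subseteq> G" by (meson open_contains_cball)
  \<comment> \<open>The curve is the tangent segment pulled back by \<open>g\<close>. Both
    \<open>\<alpha>\<close> and \<open>\<beta>\<close> vanish on the segment, hence both quadratic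
    forms vanish on the curve.\<close>
  define c where "c t = g (z + t *\<^sub>R w)" for t
  have G: "z + t *\<^sub>R w \<in> V" "c t \<in> O'" if "t \<in> {0..e}" for t
  proof -
    have "t \<in> G" using that e by (auto simp: subset_iff dist_norm)
    then show "z + t *\<^sub>R w \<in> V" "c t \<in> O'" by (auto simp: G_def c_def)
  qed
  have cN: "c t \<in> Nset A B" if t: "t \<in> {0..e}" for t
  proof -
    have "\<Phi> (c t) = z + t *\<^sub>R w" using G(1)[OF t] UV(5) unfolding c_def by (metis homeomorphism_apply2)
    moreover have "\<alpha> \<bullet> \<Phi> (c t) = (c t \<bullet> (A *v c t)) / 2" "\<beta> \<bullet> \<Phi> (c t) = (c t \<bullet> (B *v c t)) / 2"
      using a b by (simp_all add: \<Phi>_def inner_add_right)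
    moreover have "\<alpha> \<bullet> (z + t *\<^sub>R w) = 0" "\<beta> \<bullet> (z + t *\<^sub>R w) = 0"
      using zz w by (simp_all add: \<alpha>_def \<beta>_def inner_add_right inner_commute)
    ultimately have "Qf A (c t) = 0" "Qf B (c t) = 0" by (simp_all add: Qf_def)
    moreover have "D (c t) \<noteq> 0" using G(2)[OF t] by (simp add: O'_def)
    then have "lin_indep2 (A *v c t) (B *v c t)" unfolding D_def by (rule lin_indep2I_det)
    ultimately show ?thesis by (simp add: Nset_def)
  qed
  have "continuous_on {0..e} c" unfolding c_def
    by (rule continuous_on_compose2[OF contg]) (auto intro!: continuous_intros G)
  then have "connected (c ` {0..e})" by (simp add: connected_continuous_image)
  moreover have c0: "c 0 = z" by (simp add: c_def gz)
  ultimately have "c ` {0..e} \<subseteq> connected_component_set (Nset A B) z"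
    using cN e by (intro connected_component_maximal) force+
  then have cX: "c t \<in> connected_component_set (Nset A B) z \<inter> U" if "t \<in> {0..e}" for t
    using that G(2)[OF that] unfolding O'_def by blast
  let ?X = "connected_component_set (Nset A B) z \<inter> U"
  have "((\<lambda>t. z + t *\<^sub>R w) has_derivative (\<lambda>t. t *\<^sub>R w)) (at 0)"
    by (auto intro!: derivative_eq_intros)
  then have "(c has_derivative (\<lambda>t. t *\<^sub>R w)) (at 0)"
    unfolding c_def using has_derivative_compose[of "\<lambda>t. z + t *\<^sub>R w" _ 0 UNIV g id] derg by simp
  show ?thesis
  proof (rule ccontr)
    \<comment> \<open>The part \<open>x\<close> of \<open>w\<close> orthogonal to the span
      annihilates the curve for \<open>t\<close> in \<open>{0..e}\<close>, while the derivative of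
      \<open>x \<bullet> c t\<close> at 0 is the nonzero number
      \<open>x \<bullet> w\<close>.\<close>
    assume nw: "w \<notin> span ?X"
    obtain y x where yx: "y \<in> span ?X" "\<And>v. v \<in> span ?X \<Longrightarrow> orthogonal x v" "w = y + x"
      using orthogonal_subspace_decomp_exists[of ?X w] by metis
    have "x \<bullet> w = x \<bullet> x" using yx by (simp add: inner_add_right orthogonal_def)
    moreover have "x \<noteq> 0" using nw yx by auto
    ultimately have xw: "x \<bullet> w \<noteq> 0" by simp
    have "((\<lambda>t. x \<bullet> c t) has_derivative (\<lambda>t. x \<bullet> (t *\<^sub>R w))) (at 0)"
      using \<open>(c has_derivative (\<lambda>t. t *\<^sub>R w)) (at 0)\<close> by (rule has_derivative_inner_right)
    moreover have "(\<lambda>t. x \<bullet> (t *\<^sub>R w)) = (*) (x \<bullet> w)" by (auto simp: fun_eq_iff)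
    ultimately have derx: "((\<lambda>t. x \<bullet> c t) has_real_derivative (x \<bullet> w)) (at 0 within {0..e})"
      by (metis has_derivative_at_withinI has_field_derivative_def)
    have "x \<bullet> c t = 0" if "t \<in> {0..e}" for t
      using yx(2)[OF span_base[OF cX[OF that]]] by (simp add: orthogonal_def)
    then have "((\<lambda>t. 0) has_real_derivative (x \<bullet> w)) (at 0 within {0..e})"
      using e by (intro has_field_derivative_transform_within[OF derx zero_less_one]) auto
    moreover have "((\<lambda>t. 0) has_real_derivative 0) (at 0 within {0..e})" by simp
    ultimately have "x \<bullet> w = 0"
      by (rule has_field_derivative_unique) (use e in \<open>simp add: at_within_Icc_at_right\<close>)
    with xw show False ..
  qed
qed

section \<open>Components contained in a hyperplane\<close>

lemma span_pair_of_orthogonal: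
  fixes x u v :: "'a::euclidean_space"
  assumes "\<And>y. y \<bullet> u = 0 \<Longrightarrow> y \<bullet> v = 0 \<Longrightarrow> x \<bullet> y = 0"
  obtains a b where "x = a *\<^sub>R u + b *\<^sub>R v"
proof -
  obtain y z where yz: "y \<in> span {u, v}" "\<And>w. w \<in> span {u, v} \<Longrightarrow> orthogonal z w" "x = y + z"
    using orthogonal_subspace_decomp_exists[of "{u, v}" x] by metis
  have "z \<bullet> u = 0" "z \<bullet> v = 0" using yz(2) by (auto simp: orthogonal_def span_base)
  then have "x \<bullet> z = 0" by (rule assms)
  moreover have "y \<bullet> z = 0" using yz by (simp add: orthogonal_def inner_commute)
  ultimately have "z = 0" using yz(3) by (simp add: inner_add_left)
  then have "x \<in> span {u, v}" using yz by simp
  then obtain a where "x - a *\<^sub>R u \<in> span {v}" by (auto simp: span_breakdown_eq)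
  then obtain b where "x - a *\<^sub>R u = b *\<^sub>R v" by (auto simp: span_singleton)
  then show ?thesis using that by (metis add.commute diff_add_cancel)
qed

text \<open>The coefficient pairs of \<open>x\<close> and \<open>y\<close> lie in the kernel of one
  nonzero functional on the coordinate plane, so their determinant vanishes.\<close>

lemma proportional_in_plane:
  fixes u v s :: "'a::real_inner"
  assumes x: "x = a *\<^sub>R u + b *\<^sub>R v" "x \<bullet> s = 0" and y: "y = c *\<^sub>R u + d *\<^sub>R v" "y \<bullet> s = 0" "y \<noteq> 0"
    and s: "u \<bullet> s \<noteq> 0 \<or> v \<bullet> s \<noteq> 0"
  obtains r where "x = r *\<^sub>R y"
proof -
  have e: "a * (u \<bullet> s) + b * (v \<bullet> s) = 0" "c * (u \<bullet> s) + d * (v \<bullet> s) = 0"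
    using x y by (simp_all add: inner_add_left)
  have "(a * d - b * c) * (u \<bullet> s) = d * (a * (u \<bullet> s) + b * (v \<bullet> s)) - b * (c * (u \<bullet> s) + d * (v \<bullet> s))"
    "(a * d - b * c) * (v \<bullet> s) = a * (c * (u \<bullet> s) + d * (v \<bullet> s)) - c * (a * (u \<bullet> s) + b * (v \<bullet> s))"
    by (simp_all add: algebra_simps)
  then have ad: "a * d = b * c" using s unfolding e by auto
  consider "c \<noteq> 0" | "d \<noteq> 0" using y by fastforce
  then show ?thesis
  proof cases
    case 1
    then have "x = (a / c) *\<^sub>R y" using ad by (simp add: x y scaleR_add_right)
    then show ?thesis by (rule that)
  next
    case 2
    then have "x = (b / d) *\<^sub>R y" using ad by (simp add: x y scaleR_add_right) (simp add: field_simps)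
    then show ?thesis by (rule that)
  qed
qed

text \<open>\<open>X\<close> maps the orthogonal complement \<open>T\<close> of \<open>u\<close> and
  \<open>v\<close> into their span, and that span into the span of two images; four vectors
  therefore span the range.\<close>

lemma rank_le_4_of_vanishing:
  assumes X: "symmetric_mat X" and zero: "\<And>y. y \<bullet> u = 0 \<Longrightarrow> y \<bullet> v = 0 \<Longrightarrow> Qf X y = 0"
  shows "rank X \<le> 4"
proof -
  define T where "T = {y. y \<bullet> u = 0 \<and> y \<bullet> v = 0}"
  have T: "subspace T" unfolding T_def subspace_def by (auto simp: inner_add_left)
  have XT: "X *v t \<in> span {u, v}" if "t \<in> T" for t
  proof -
    have "(X *v t) \<bullet> y = 0" if "y \<bullet> u = 0" "y \<bullet> v = 0" for y
      using sym_bilinear_eq_0I[OF mform_sym_bilinear[OF X] T, of t y] \<open>t \<in> T\<close> that zero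
      by (simp add: T_def Qf_mform[symmetric]) (simp add: mform_def mform_swap[OF X])
    then obtain a b where "X *v t = a *\<^sub>R u + b *\<^sub>R v" by (rule span_pair_of_orthogonal)
    then show ?thesis by (simp add: span_add span_base span_scale)
  qed
  let ?W = "{u, v, X *v u, X *v v}"
  have "X *v y \<in> span ?W" for y
  proof -
    obtain p t where pt: "p \<in> span {u, v}" "\<And>w. w \<in> span {u, v} \<Longrightarrow> orthogonal t w" "y = p + t"
      using orthogonal_subspace_decomp_exists[of "{u, v}" y] by metis
    have "t \<in> T" using pt(2) by (auto simp: T_def orthogonal_def span_base)
    have "X *v t \<in> span ?W" using XT[OF \<open>t \<in> T\<close>] span_mono[of "{u, v}" ?W] by blast
    moreover have "X *v p \<in> span ((*v) X ` {u, v})"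
      using pt(1) by (simp add: linear_span_image del: image_insert)
    then have "X *v p \<in> span ?W" using span_mono[of "(*v) X ` {u, v}" ?W] by auto
    ultimately show ?thesis by (simp add: pt matrix_vector_right_distrib span_add)
  qed
  then have "dim (range ((*v) X)) \<le> card ?W" by (intro dim_le_card) auto
  also have "\<dots> \<le> 4" using card_length[of "[u, v, X *v u, X *v v]"] by simp
  finally show ?thesis by (simp add: rank_dim_range)
qed

text \<open>Expanding \<open>m\<close> at the projection of \<open>w\<close> to the hyperplane gives
  zero, and every term other than \<open>m w w\<close> contains the factor
  \<open>l \<bullet> w\<close>.\<close>

lemma product_of_vanishing_on_hyperplane:
  fixes l :: "'a::real_inner"
  assumes m: "sym_bilinear m" and l: "l \<noteq> 0" and zero: "\<And>h. l \<bullet> h = 0 \<Longrightarrow> m h h = 0"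
  shows "\<exists>f g. linear f \<and> linear g \<and> (\<forall>w. m w w = f w * (g w :: real))"
proof -
  define k where "k = l \<bullet> l"
  have k: "k \<noteq> 0" using l by (simp add: k_def)
  have lin: "linear (\<lambda>w. l \<bullet> w)" by (auto simp: linear_iff inner_add_right)
  have "linear (\<lambda>w. (2 / k) * m l w + (- m l l / k\<^sup>2) * (l \<bullet> w))"
    by (rule linear_real_combination[OF sym_bilinear_linear[OF m] lin])
  moreover have "m w w = (l \<bullet> w) * ((2 / k) * m l w + (- m l l / k\<^sup>2) * (l \<bullet> w))" for w
  proof -
    define t where "t = (l \<bullet> w) / k"
    have "l \<bullet> (w + (- t) *\<^sub>R l) = 0" using k by (simp add: inner_diff_right t_def k_def[symmetric])
    from zero[OF this] have "m w w = t * (2 * m l w - t * m l l)"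
      unfolding sym_bilinear_line[OF m] by (simp add: sym_bilinear_commute[OF m, of w l] power2_eq_square algebra_simps)
    also have "\<dots> = (l \<bullet> w) * ((2 / k) * m l w + (- m l l / k\<^sup>2) * (l \<bullet> w))"
      by (simp add: t_def power2_eq_square algebra_simps)
    finally show ?thesis .
  qed
  ultimately show ?thesis using lin by blast
qed

text \<open>A normal \<open>l\<close> of the hyperplane is a combination of the two gradients at
  each point of the component \<open>S\<close>. Fixing the coefficients at one point gives a matrix
  \<open>M\<close> of the pencil which turns out to map an open piece of \<open>S\<close> into the
  line of \<open>l\<close>, and then the whole hyperplane as well. So \<open>M\<close> vanishes as a
  form on the hyperplane.\<close>

lemma product_of_nonspanning_component:
  fixes A B :: "'d::finite smat"
  assumes A: "symmetric_mat A" and B: "symmetric_mat B"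
    and z1: "z1 \<in> Nset A B" "span (connected_component_set (Nset A B) z1) \<noteq> UNIV"
    and nv: "\<And>u v. \<exists>y. y \<bullet> u = 0 \<and> y \<bullet> v = 0 \<and> (Qf A y \<noteq> 0 \<or> Qf B y \<noteq> 0)"
  shows "has_product_element (mform A) (mform B)"
proof -
  define S where "S = connected_component_set (Nset A B) z1"
  have SN: "y \<in> Nset A B" if "y \<in> S" for y
    using that connected_component_subset unfolding S_def by blast
  have tang: "w \<in> span (S \<inter> U)" if "y \<in> S" "open U" "y \<in> U" "w \<bullet> (A *v y) = 0" "w \<bullet> (B *v y) = 0" for w y U
  proof -
    have "connected_component_set (Nset A B) y = S"
      using that(1) connected_component_eq unfolding S_def by blast
    then show ?thesis using tangent_vector_in_span[OF A B SN[OF that(1)] that(2-5)] by simp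
  qed
  \<comment> \<open>Each open piece of \<open>S\<close> has two points with one outside the tangent
    space at the other. Otherwise both forms would vanish on the span of the piece, which contains a
    tangent space of codimension two, against \<open>nv\<close>.\<close>
  have full: "\<exists>y\<in>S \<inter> U. \<exists>s\<in>S \<inter> U. s \<bullet> (A *v y) \<noteq> 0 \<or> s \<bullet> (B *v y) \<noteq> 0"
    if U: "open U" and y0: "y0 \<in> S \<inter> U" for U y0
  proof (rule ccontr)
    assume "\<not> ?thesis"
    then have *: "mform A s y = 0" "mform B s y = 0" if "s \<in> S \<inter> U" "y \<in> S \<inter> U" for s y
      using that unfolding mform_def by blast+
    have ext: "mform M x x = 0"
      if M: "symmetric_mat M" and 0: "\<And>s y. s \<in> S \<inter> U \<Longrightarrow> y \<in> S \<inter> U \<Longrightarrow> mform M s y = 0"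
        and x: "x \<in> span (S \<inter> U)" for M x
    proof -
      note lin = sym_bilinear_linear[OF mform_sym_bilinear[OF M]]
      have "mform M s x = 0" if "s \<in> S \<inter> U" for s
        using linear_eq_0_on_span[OF lin 0 x] that by blast
      then have "mform M x s = 0" if "s \<in> S \<inter> U" for s
        using that sym_bilinear_commute[OF mform_sym_bilinear[OF M]] by metis
      then show ?thesis using linear_eq_0_on_span[OF lin _ x] by blast
    qed
    obtain y where y: "y \<bullet> (A *v y0) = 0" "y \<bullet> (B *v y0) = 0" "Qf A y \<noteq> 0 \<or> Qf B y \<noteq> 0"
      using nv by blast
    have "y \<in> span (S \<inter> U)" using tang[OF _ U _ y(1,2)] y0 by blast
    then show False using ext[OF A *(1)] ext[OF B *(2)] y(3) unfolding Qf_mform by blast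
  qed
  obtain l where l: "l \<noteq> 0" "\<And>x. x \<in> S \<Longrightarrow> l \<bullet> x = 0"
    using span_not_UNIV_orthogonal[OF z1(2)] unfolding S_def by (meson span_base)
  have lspan: "\<exists>a b. l = a *\<^sub>R (A *v y) + b *\<^sub>R (B *v y)" if "y \<in> S" for y
  proof -
    have "l \<bullet> w = 0" if w: "w \<bullet> (A *v y) = 0" "w \<bullet> (B *v y) = 0" for w
    proof -
      have "w \<in> span S" using tang[OF \<open>y \<in> S\<close> open_UNIV UNIV_I w] by simp
      moreover have "linear (\<lambda>x. l \<bullet> x)" by (auto simp: linear_iff inner_add_right)
      ultimately show ?thesis using linear_eq_0_on_span l(2) by blast
    qed
    then show ?thesis using span_pair_of_orthogonal by metis
  qed
  have "z1 \<in> S \<inter> UNIV" using z1 by (simp add: S_def)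
  from full[OF open_UNIV this] obtain z z2 where
    z: "z \<in> S" "z2 \<in> S" "z2 \<bullet> (A *v z) \<noteq> 0 \<or> z2 \<bullet> (B *v z) \<noteq> 0" by blast
  obtain a b where ab: "l = a *\<^sub>R (A *v z) + b *\<^sub>R (B *v z)" using lspan z by blast
  define M where "M = a *\<^sub>R A + b *\<^sub>R B"
  have M: "symmetric_mat M" unfolding M_def using A B by (rule symmetric_mat_combination)
  have Mz: "M *v z = l" by (simp add: M_def ab matrix_combination_vec)
  \<comment> \<open>On \<open>U\<close> the vector \<open>z\<close> is not orthogonal to both
    gradients at \<open>y\<close>. As \<open>M *v y\<close> and \<open>l\<close> are orthogonal to
    \<open>z\<close> and lie in the span of these gradients, they are proportional.\<close>
  define U where "U = {y. y \<bullet> (A *v z) \<noteq> 0 \<or> y \<bullet> (B *v z) \<noteq> 0}"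
  have U: "open U" unfolding U_def
    by (intro open_Collect_disj open_Collect_neq continuous_intros)
  have My: "\<exists>r. M *v y = r *\<^sub>R l" if y: "y \<in> S \<inter> U" for y
  proof -
    obtain a' b' where l': "l = a' *\<^sub>R (A *v y) + b' *\<^sub>R (B *v y)" using lspan y by blast
    have "(M *v y) \<bullet> z = 0" using l(2) y Mz by (metis IntD1 inner_commute mform_swap[OF M])
    moreover have "l \<bullet> z = 0" using l z by blast
    moreover have "(A *v y) \<bullet> z \<noteq> 0 \<or> (B *v y) \<bullet> z \<noteq> 0"
      using y by (simp add: U_def mform_swap[OF A] mform_swap[OF B])
    ultimately show ?thesis
      using proportional_in_plane[of "M *v y" a "A *v y" b "B *v y" z l a' b'] l(1) l'
      by (metis M_def matrix_combination_vec)
  qed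
  have "z2 \<in> S \<inter> U" using z by (simp add: U_def)
  from full[OF U this] obtain y s where
    ys: "y \<in> S \<inter> U" "s \<in> S \<inter> U" "s \<bullet> (A *v y) \<noteq> 0 \<or> s \<bullet> (B *v y) \<noteq> 0" by blast
  have vanish: "mform M h h = 0" if h: "l \<bullet> h = 0" for h
  proof -
    have orth: "(M *v h) \<bullet> p = 0" if p: "p \<in> S \<inter> U" for p
    proof -
      obtain r where "M *v p = r *\<^sub>R l" using My[OF p] by blast
      then have "p \<bullet> (M *v h) = 0" using h by (simp add: mform_swap[OF M])
      then show ?thesis by (simp add: inner_commute)
    qed
    \<comment> \<open>The tangent space at \<open>y\<close> is spanned from within
      \<open>S \<inter> U\<close>, so the same proportionality argument applies to
      \<open>M *v h\<close>, now with \<open>s\<close> in place of \<open>z\<close>.\<close>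
    have "(M *v h) \<bullet> w = 0" if w: "w \<bullet> (A *v y) = 0" "w \<bullet> (B *v y) = 0" for w
    proof -
      have "w \<in> span (S \<inter> U)" using tang[OF _ U _ w] ys by blast
      moreover have "linear (\<lambda>x. (M *v h) \<bullet> x)" by (auto simp: linear_iff inner_add_right)
      ultimately show ?thesis using linear_eq_0_on_span orth by blast
    qed
    then obtain a1 b1 where 1: "M *v h = a1 *\<^sub>R (A *v y) + b1 *\<^sub>R (B *v y)"
      using span_pair_of_orthogonal by metis
    obtain a2 b2 where 2: "l = a2 *\<^sub>R (A *v y) + b2 *\<^sub>R (B *v y)" using lspan ys by blast
    have "l \<bullet> s = 0" using l ys by blast
    moreover have "(A *v y) \<bullet> s \<noteq> 0 \<or> (B *v y) \<bullet> s \<noteq> 0" using ys by (simp add: inner_commute)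
    ultimately obtain r where "M *v h = r *\<^sub>R l"
      using proportional_in_plane[OF 1 orth[OF ys(2)] 2 _ l(1)] by blast
    then show ?thesis using h by (simp add: mform_def inner_commute)
  qed
  obtain f g where fg: "linear f" "linear g" "\<forall>w. mform M w w = f w * g w"
    using product_of_vanishing_on_hyperplane[OF mform_sym_bilinear[OF M] l(1) vanish] by blast
  have "a \<noteq> 0 \<or> b \<noteq> 0" using l(1) ab by auto
  then show ?thesis
    unfolding has_product_element_def
    by (intro exI[of _ a] exI[of _ b] exI[of _ f] exI[of _ g])
      (use fg in \<open>simp add: M_def mform_combination\<close>)
qed

section \<open>The Poisson bracket\<close>

text \<open>This is the standard complex structure J, with the sign that makes
  \<open>symp_form u v\<close> the inner product of \<open>J u\<close> with
  \<open>v\<close>.\<close>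

definition hamiltonian_dual :: "'d::finite phase \<Rightarrow> 'd phase" where
  "hamiltonian_dual u = (\<chi> i. case i of Inl j \<Rightarrow> u $ Inr j | Inr j \<Rightarrow> - u $ Inl j)"

lemma symp_form_inner: "symp_form u v = hamiltonian_dual u \<bullet> v"
  unfolding symp_form_def hamiltonian_dual_def inner_vec_def UNIV_Plus_UNIV[symmetric]
  by (simp add: sum.Plus sum.distrib[symmetric] sum_subtractf sum_negf del: UNIV_Plus_UNIV)

lemma hamiltonian_dual_twice: "hamiltonian_dual (hamiltonian_dual u) = - u"
  by (simp add: vec_eq_iff hamiltonian_dual_def split: sum.split)

lemma symp_form_self: "symp_form u u = 0"
  by (simp add: symp_form_def mult.commute)

text \<open>A change of basis of the pencil multiplies the bracket by its determinant.\<close>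

lemma symp_form_combination:
  "symp_form (a *\<^sub>R u + b *\<^sub>R v) (c *\<^sub>R u + d *\<^sub>R v) = (a * d - b * c) * symp_form u v"
  unfolding symp_form_def sum_distrib_left
  by (rule sum.cong) (simp_all add: algebra_simps)

lemma symp_form_add_scaleR_left:
  "symp_form (a *\<^sub>R u + b *\<^sub>R v) w = a * symp_form u w + b * symp_form v w"
  unfolding symp_form_def sum_distrib_left sum.distrib[symmetric]
  by (rule sum.cong) (simp_all add: algebra_simps)

text \<open>The gradients are \<open>2 *\<^sub>R (A *v z)\<close> and
  \<open>2 *\<^sub>R (B *v z)\<close>, whence the factor 4.\<close>

lemma poisson_Qf:
  assumes A: "symmetric_mat A" and B: "symmetric_mat B"
  shows "poisson (Qf A) (Qf B) z = 4 * symp_form (A *v z) (B *v z)"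
proof -
  have pd: "pderiv_at (Qf M) i z = 2 * (M *v z) $ i" if M: "symmetric_mat M" for M :: "'a smat" and i
  proof -
    have "((\<lambda>y. 2 * ((y \<bullet> (M *v y)) / 2)) has_derivative (\<lambda>h. 2 * ((M *v z) \<bullet> h))) (at z)"
      by (rule has_derivative_mult_right[OF has_derivative_half_Qf[OF M]])
    then have "(Qf M has_derivative (\<lambda>h. 2 * ((M *v z) \<bullet> h))) (at z)"
      by (simp add: Qf_def[abs_def])
    then have "frechet_derivative (Qf M) (at z) = (\<lambda>h. 2 * ((M *v z) \<bullet> h))"
      by (rule frechet_derivative_at[symmetric])
    then show ?thesis by (simp add: pderiv_at_def inner_axis)
  qed
  show ?thesis
    unfolding poisson_def pd[OF A] pd[OF B] symp_form_def sum_distrib_left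
    by (rule sum.cong) (simp_all add: algebra_simps)
qed

section \<open>Product forms and their brackets\<close>

lemma symmetric_mat_eqI:
  assumes "symmetric_mat M" "symmetric_mat M'" "\<And>z. Qf M z = Qf M' z"
  shows "M = M'"
proof -
  have "sym_bilinear (\<lambda>x y. 1 * mform M x y + (-1) * mform M' x y)"
    using assms by (intro sym_bilinear_combination mform_sym_bilinear)
  from sym_bilinear_eq_0I[OF this subspace_UNIV] have "x \<bullet> (M *v y) = x \<bullet> (M' *v y)" for x y
    using assms(3) by (simp add: Qf_mform) (simp add: mform_def)
  then have "M *v y = M' *v y" for y by (metis vector_eq_ldot)
  then show ?thesis by (simp add: matrix_eq)
qed

text \<open>Polar forms are unique, and \<open>n\<close> is the polar form of the product.\<close>

lemma product_matrix_vec: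
  assumes M: "symmetric_mat M" and QM: "\<And>z. Qf M z = (l \<bullet> z) * (m \<bullet> z)"
  shows "M *v z = ((l \<bullet> z) / 2) *\<^sub>R m + ((m \<bullet> z) / 2) *\<^sub>R l"
proof -
  define n where "n x y = ((l \<bullet> x) * (m \<bullet> y) + (m \<bullet> x) * (l \<bullet> y)) / 2" for x y
  have n: "sym_bilinear n"
    unfolding sym_bilinear_def bilinear_def n_def linear_iff
    by (auto simp: inner_add_right add_divide_distrib algebra_simps)
  have "sym_bilinear (\<lambda>x y. 1 * mform M x y + (-1) * n x y)"
    using M n by (intro sym_bilinear_combination mform_sym_bilinear)
  from sym_bilinear_eq_0I[OF this subspace_UNIV, of x z for x]
  have "mform M x z = n x z" for x
    using QM by (simp add: Qf_mform) (simp add: n_def)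
  then have "x \<bullet> (M *v z) = x \<bullet> (((l \<bullet> z) / 2) *\<^sub>R m + ((m \<bullet> z) / 2) *\<^sub>R l)" for x
    by (simp add: mform_def n_def inner_add_right inner_commute algebra_simps add_divide_distrib)
  then show ?thesis by (metis vector_eq_ldot)
qed

lemma multiple_of_orthogonal:
  fixes x u :: "'a::euclidean_space"
  assumes "\<And>y. u \<bullet> y = 0 \<Longrightarrow> x \<bullet> y = 0"
  obtains c where "x = c *\<^sub>R u"
  using span_pair_of_orthogonal[of u u x] assms by (metis inner_commute scaleR_add_left)

text \<open>On \<open>l = 0\<close> the form \<open>G\<close> is indefinite, so \<open>C\<close> is
  a multiple of \<open>G\<close> there, and the multiple is zero by evaluation at \<open>y\<close>.
  Thus a product of two functionals vanishes on the hyperplane, and the factor \<open>m\<close> is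
  not the zero one. In other words, \<open>J l\<close> is an eigenvector of
  \<open>J G\<close>.\<close>

lemma hamiltonian_dual_eigenvector:
  assumes G: "symmetric_mat G" and C: "symmetric_mat C" and \<kappa>: "\<kappa> \<noteq> 0"
    and QC: "\<And>z. l \<bullet> z = 0 \<Longrightarrow> Qf C z = \<kappa> * ((m \<bullet> z) * (hamiltonian_dual l \<bullet> (G *v z)))"
    and vanish: "\<And>z. l \<bullet> z = 0 \<Longrightarrow> Qf G z = 0 \<Longrightarrow> Qf C z = 0"
    and p: "l \<bullet> p = 0" "Qf G p > 0" and q: "l \<bullet> q = 0" "Qf G q < 0"
    and y: "l \<bullet> y = 0" "m \<bullet> y = 0" "Qf G y \<noteq> 0"
    and x: "l \<bullet> x = 0" "m \<bullet> x \<noteq> 0"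
  obtains c where "G *v hamiltonian_dual l = c *\<^sub>R l"
proof -
  have V: "subspace {z. l \<bullet> z = 0}" unfolding subspace_def by (auto simp: inner_add_right)
  obtain t where t: "\<And>z. l \<bullet> z = 0 \<Longrightarrow> Qf C z = t * Qf G z"
    using proportional_on_isotropic_cone[OF mform_sym_bilinear[OF G] mform_sym_bilinear[OF C] V, of p q]
      p q vanish unfolding Qf_mform by auto
  have "t = 0" using t[OF y(1)] QC[OF y(1)] y by simp
  then have zero: "m \<bullet> z = 0 \<or> (G *v hamiltonian_dual l) \<bullet> z = 0" if "l \<bullet> z = 0" for z
    using t[OF that] QC[OF that] \<kappa> by (simp add: mform_swap[OF G])
  \<comment> \<open>A vector space is not the union of two proper subspaces; \<open>x\<close> and
    \<open>z + x\<close> make this explicit.\<close>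
  have "(G *v hamiltonian_dual l) \<bullet> z = 0" if "l \<bullet> z = 0" for z
    using zero[of z] zero[of "z + x"] zero[of x] x that by (auto simp: inner_add_right)
  then show ?thesis using multiple_of_orthogonal that by metis
qed

text \<open>The vector \<open>h = J l\<close> is isotropic for \<open>G\<close> and
  \<open>G\<close>-orthogonal to \<open>l = 0\<close>. If \<open>m\<close> did not kill
  \<open>h\<close>, adding a multiple of \<open>x\<close> would reach \<open>m = 0\<close> with a
  negative value. A zero of a form that is nonnegative on \<open>m = 0\<close> is in its radical
  there, which forces \<open>c = 0\<close>.\<close>

lemma hamiltonian_dual_in_kernel:
  assumes G: "symmetric_mat G" and c: "G *v hamiltonian_dual l = c *\<^sub>R l"
    and nonneg: "\<And>z. m \<bullet> z = 0 \<Longrightarrow> Qf G z \<ge> 0"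
    and x: "l \<bullet> x = 0" "Qf G x < 0" and y: "m \<bullet> y = 0" "l \<bullet> y \<noteq> 0"
  shows "m \<bullet> hamiltonian_dual l = 0" "G *v hamiltonian_dual l = 0"
proof -
  define h where "h = hamiltonian_dual l"
  have lh: "l \<bullet> h = 0" using symp_form_self[of l] by (simp add: symp_form_inner h_def inner_commute)
  have hv: "mform G h v = c * (l \<bullet> v)" for v
    using c by (simp add: mform_def mform_swap[OF G] h_def)
  have line: "Qf G (h + t *\<^sub>R v) = 2 * t * c * (l \<bullet> v) + t\<^sup>2 * Qf G v" for t v
    unfolding Qf_mform sym_bilinear_line[OF mform_sym_bilinear[OF G]] hv lh by simp
  have mx: "m \<bullet> x \<noteq> 0" using nonneg[of x] x by auto
  define t where "t = - (m \<bullet> h) / (m \<bullet> x)"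
  have "m \<bullet> (h + t *\<^sub>R x) = 0" using mx unfolding inner_add_right by (simp add: t_def)
  from nonneg[OF this] have "t\<^sup>2 * Qf G x \<ge> 0" by (simp add: line x)
  then have "t = 0" using x by (auto simp: zero_le_mult_iff)
  then show mh: "m \<bullet> hamiltonian_dual l = 0" using mx by (simp add: t_def h_def)
  define k r where "k = c * (l \<bullet> y)" and "r = Qf G y"
  have r: "r \<ge> 0" using nonneg y by (simp add: r_def)
  \<comment> \<open>The denominator \<open>r + 1\<close> rather than \<open>r\<close> also covers
    \<open>r = 0\<close>; the value of \<open>G\<close> becomes negative unless
    \<open>k = 0\<close>.\<close>
  have "m \<bullet> (h + (- k / (r + 1)) *\<^sub>R y) = 0" using mh y unfolding inner_add_right by (simp add: h_def)
  from nonneg[OF this] have "2 * (- k / (r + 1)) * k + (- k / (r + 1))\<^sup>2 * r \<ge> 0"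
    unfolding line by (simp add: k_def r_def algebra_simps)
  also have "2 * (- k / (r + 1)) * k + (- k / (r + 1))\<^sup>2 * r = - (k\<^sup>2 * (r + 2) / (r + 1)\<^sup>2)"
    using r by (simp add: divide_simps power2_eq_square) (simp add: algebra_simps)
  finally have "k\<^sup>2 * (r + 2) / (r + 1)\<^sup>2 \<le> 0" by simp
  then have "k = 0" using r by (auto simp: divide_le_0_iff mult_le_0_iff)
  then have "c = 0" using y by (simp add: k_def)
  then show "G *v hamiltonian_dual l = 0" using c by simp
qed

text \<open>If \<open>G\<close> is indefinite on both hyperplanes, the two eigenvector relations
  turn the bracket into a multiple of \<open>M\<close>. The S-lemma gives indefiniteness on at least
  one of them, and \<open>kern\<close> excludes that it holds on only one.\<close>

proposition bracket_with_product_form: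
  fixes M G C :: "'d::finite smat"
  assumes M: "symmetric_mat M" and G: "symmetric_mat G" and C: "symmetric_mat C"
    and QM: "\<And>z. Qf M z = (l \<bullet> z) * (m \<bullet> z)"
    and nd: "\<And>s t. (\<And>z. s * Qf M z + t * Qf G z \<ge> 0) \<Longrightarrow> s = 0 \<and> t = 0"
    and y: "l \<bullet> y = 0" "m \<bullet> y = 0" "Qf G y \<noteq> 0"
    and \<kappa>: "\<kappa> \<noteq> 0" and QC: "\<And>z. Qf C z = \<kappa> * symp_form (M *v z) (G *v z)"
    and vanish: "\<And>z. Qf M z = 0 \<Longrightarrow> Qf G z = 0 \<Longrightarrow> Qf C z = 0"
    and kern: "\<And>u. M *v u = 0 \<Longrightarrow> G *v u = 0 \<Longrightarrow>
       (\<And>v. M *v v = 0 \<Longrightarrow> G *v v = 0 \<Longrightarrow> symp_form u v = 0) \<Longrightarrow> u = 0"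
  shows "\<exists>c. C = c *\<^sub>R M"
proof -
  let ?J = hamiltonian_dual
  note Mvec = product_matrix_vec[OF M QM]
  have QC': "Qf C z = \<kappa> / 2 * ((m \<bullet> z) * (?J l \<bullet> (G *v z)) + (l \<bullet> z) * (?J m \<bullet> (G *v z)))" for z
    unfolding QC Mvec symp_form_add_scaleR_left by (simp add: symp_form_inner algebra_simps)
  have indef: "\<exists>z. Qf M z > 0" "\<exists>z. Qf M z < 0"
    using nd[of "-1" 0] nd[of 1 0] by (auto simp: not_le[symmetric])
  have lm: "\<exists>x. l \<bullet> x = 0 \<and> m \<bullet> x \<noteq> 0"
  proof (rule ccontr)
    assume "\<not> ?thesis"
    then obtain c where "m = c *\<^sub>R l" using multiple_of_orthogonal[of l m] by blast
    then have "Qf M z = c * (l \<bullet> z)\<^sup>2" for z using QM by (simp add: power2_eq_square)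
    then show False using indef by (auto simp: zero_less_mult_iff mult_less_0_iff)
  qed
  have ml: "\<exists>x. m \<bullet> x = 0 \<and> l \<bullet> x \<noteq> 0"
  proof (rule ccontr)
    assume "\<not> ?thesis"
    then obtain c where "l = c *\<^sub>R m" using multiple_of_orthogonal[of m l] by blast
    then have "Qf M z = c * (m \<bullet> z)\<^sup>2" for z using QM by (simp add: power2_eq_square)
    then show False using indef by (auto simp: zero_less_mult_iff mult_less_0_iff)
  qed
  have l0: "l \<noteq> 0" and m0: "m \<noteq> 0" using lm ml by auto
  have kerM: "M *v v = 0 \<longleftrightarrow> l \<bullet> v = 0 \<and> m \<bullet> v = 0" for v
  proof
    assume *: "M *v v = 0"
    obtain x where x: "l \<bullet> x = 0" "m \<bullet> x \<noteq> 0" using lm by blast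
    obtain x' where x': "m \<bullet> x' = 0" "l \<bullet> x' \<noteq> 0" using ml by blast
    show "l \<bullet> v = 0 \<and> m \<bullet> v = 0"
      using arg_cong[OF *, of "\<lambda>w. w \<bullet> x"] arg_cong[OF *, of "\<lambda>w. w \<bullet> x'"] x x'
      by (simp add: Mvec inner_add_left)
  qed (simp add: Mvec)
  define ind where "ind u \<longleftrightarrow> (\<exists>p q. u \<bullet> p = 0 \<and> u \<bullet> q = 0 \<and> Qf G p > 0 \<and> Qf G q < 0)" for u
  \<comment> \<open>There are zeros \<open>u\<close> and \<open>v\<close> of \<open>M\<close> with
    opposite signs of \<open>G\<close>, each on one of the hyperplanes. If they lie on different
    ones, \<open>y\<close> lies on both and pairs with the one of opposite sign.\<close>
  have both: "ind l \<or> ind m"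
  proof -
    have G': "sym_bilinear (\<lambda>x y. - mform G x y)"
      using sym_bilinear_combination[OF mform_sym_bilinear[OF G] mform_sym_bilinear[OF G], of "-1" 0] by simp
    obtain P Q where PQ: "mform M P P > 0" "mform M Q Q < 0" using indef unfolding Qf_mform by blast
    obtain u where u: "Qf M u = 0" "Qf G u < 0"
    proof (rule ccontr)
      assume "\<not> thesis"
      then have "\<And>x. mform M x x = 0 \<Longrightarrow> mform G x x \<ge> 0" using that unfolding Qf_mform by force
      then obtain t where "\<forall>x. mform G x x + t * mform M x x \<ge> 0"
        using s_lemma[OF mform_sym_bilinear[OF M] mform_sym_bilinear[OF G] subspace_UNIV _ PQ(1) _ PQ(2)] by auto
      then show False using nd[of t 1] by (auto simp: Qf_mform algebra_simps)
    qed
    obtain v where v: "Qf M v = 0" "Qf G v > 0"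
    proof (rule ccontr)
      assume "\<not> thesis"
      then have "\<And>x. mform M x x = 0 \<Longrightarrow> - mform G x x \<ge> 0" using that unfolding Qf_mform by force
      then obtain t where "\<forall>x. - mform G x x + t * mform M x x \<ge> 0"
        using s_lemma[OF mform_sym_bilinear[OF M] G' subspace_UNIV _ PQ(1) _ PQ(2)] by auto
      then show False using nd[of t "-1"] by (auto simp: Qf_mform algebra_simps)
    qed
    have "l \<bullet> u = 0 \<or> m \<bullet> u = 0" "l \<bullet> v = 0 \<or> m \<bullet> v = 0" using u v QM by auto
    moreover have "Qf G y > 0 \<or> Qf G y < 0" using y by linarith
    ultimately show ?thesis unfolding ind_def using u(2) v(2) y(1,2) by blast
  qed
  have eigen_l: "\<exists>c. G *v ?J l = c *\<^sub>R l" if ind: "ind l"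
  proof -
    obtain p q where pq: "l \<bullet> p = 0" "Qf G p > 0" "l \<bullet> q = 0" "Qf G q < 0" using ind by (auto simp: ind_def)
    obtain x where x: "l \<bullet> x = 0" "m \<bullet> x \<noteq> 0" using lm by blast
    show ?thesis
      by (rule hamiltonian_dual_eigenvector[OF G C _ _ _ pq y x, of "\<kappa> / 2"])
        (use \<kappa> QC' vanish QM in auto)
  qed
  have eigen_m: "\<exists>c. G *v ?J m = c *\<^sub>R m" if ind: "ind m"
  proof -
    obtain p q where pq: "m \<bullet> p = 0" "Qf G p > 0" "m \<bullet> q = 0" "Qf G q < 0" using ind by (auto simp: ind_def)
    obtain x where x: "m \<bullet> x = 0" "l \<bullet> x \<noteq> 0" using ml by blast
    show ?thesis
      by (rule hamiltonian_dual_eigenvector[OF G C _ _ _ pq y(2,1,3) x, of "\<kappa> / 2"])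
        (use \<kappa> QC' vanish QM in auto)
  qed
  \<comment> \<open>If \<open>G\<close> is semidefinite on \<open>w = 0\<close>, then
    \<open>J u\<close> lies in the common kernel. That kernel is contained in \<open>u = 0\<close>,
    so it is symplectically orthogonal to \<open>J u\<close>, contradicting
    \<open>kern\<close>.\<close>
  have absurd: False
    if ul: "ind u" and uw: "\<not> ind w" and e: "G *v ?J u = c *\<^sub>R u" and u0: "u \<noteq> 0"
      and yy: "u \<bullet> y = 0" "w \<bullet> y = 0" and x: "w \<bullet> x = 0" "u \<bullet> x \<noteq> 0"
      and ker: "\<And>v. M *v v = 0 \<longleftrightarrow> u \<bullet> v = 0 \<and> w \<bullet> v = 0" for u w c x
  proof -
    have "w \<bullet> ?J u = 0 \<and> G *v ?J u = 0"
    proof (cases "Qf G y > 0")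
      case True
      then have nn: "Qf G z \<ge> 0" if "w \<bullet> z = 0" for z
        using uw that yy unfolding ind_def by (meson not_le)
      obtain q where "u \<bullet> q = 0" "Qf G q < 0" using ul by (auto simp: ind_def)
      from hamiltonian_dual_in_kernel[OF G e nn this x] show ?thesis by blast
    next
      case False
      then have "Qf G y < 0" using y by simp
      then have nn: "Qf G z \<le> 0" if "w \<bullet> z = 0" for z
        using uw that yy unfolding ind_def by (meson not_le)
      \<comment> \<open>\<open>G'\<close> is the negative of \<open>G\<close>, written as a
        combination so that the pencil lemmas apply.\<close>
      define G' where "G' = (-1) *\<^sub>R G + 0 *\<^sub>R G"
      have QG': "Qf G' z = - Qf G z" for z unfolding Qf_mform G'_def mform_combination by simp
      have G'v: "G' *v z = - (G *v z)" for z unfolding G'_def matrix_combination_vec by simp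
      have sG': "symmetric_mat G'" unfolding G'_def using G G by (rule symmetric_mat_combination)
      have e': "G' *v ?J u = (- c) *\<^sub>R u" using e by (simp add: G'v)
      have nn': "Qf G' z \<ge> 0" if "w \<bullet> z = 0" for z using nn that by (simp add: QG')
      obtain q where q: "u \<bullet> q = 0" "Qf G' q < 0" using ul by (auto simp: ind_def QG')
      from hamiltonian_dual_in_kernel[OF sG' e' nn' q x] show ?thesis by (simp add: G'v)
    qed
    moreover have "u \<bullet> ?J u = 0" using symp_form_self[of u] by (simp add: symp_form_inner inner_commute)
    ultimately have "M *v ?J u = 0" "G *v ?J u = 0" using ker by auto
    moreover have "symp_form (?J u) v = 0" if "M *v v = 0" for v
      using that ker by (simp add: symp_form_inner hamiltonian_dual_twice)
    ultimately have "?J u = 0" using kern by blast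
    then have "?J (?J u) = 0" by (simp add: hamiltonian_dual_def vec_eq_iff split: sum.split)
    then show False using u0 by (simp add: hamiltonian_dual_twice)
  qed
  have "ind l" "ind m"
    using both eigen_l eigen_m absurd[of l m] absurd[of m l] l0 m0 y lm ml kerM by blast+
  then obtain c c' where c: "G *v ?J l = c *\<^sub>R l" "G *v ?J m = c' *\<^sub>R m" using eigen_l eigen_m by blast
  have "Qf C z = Qf ((\<kappa> / 2 * (c + c')) *\<^sub>R M + 0 *\<^sub>R M) z" for z
    unfolding QC' mform_swap[OF G] c Qf_combination QM by (simp add: field_simps)
  then have "C = (\<kappa> / 2 * (c + c')) *\<^sub>R M + 0 *\<^sub>R M"
    by (intro symmetric_mat_eqI C symmetric_mat_combination M)
  then show ?thesis by (metis add.right_neutral scaleR_zero_left)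
qed

section \<open>Reduction to the bracket with a product form\<close>

theorem theorem3p5:
  fixes A B C :: "'d::finite smat"
  assumes symA: "symmetric_mat A" and symB: "symmetric_mat B" and symC: "symmetric_mat C"
    and indep: "lin_indep2 A B"
    and nondiss: "non_dissipative A B"
    and rk: "maxrank A B \<ge> 7"
    and QC: "\<forall>z. Qf C z = poisson (Qf A) (Qf B) z"
    and vanish: "\<forall>z. Qf A z = 0 \<and> Qf B z = 0 \<longrightarrow> Qf C z = 0"
    and kern: "{z. A *v z = 0} \<inter> {z. B *v z = 0} = {0} \<or>
               symplectic_subspace ({z. A *v z = 0} \<inter> {z. B *v z = 0})"
    and nospan: "\<forall>z\<in>Nset A B. span (connected_component_set (Nset A B) z) \<noteq> UNIV"
  shows "\<exists>s t. C = s *\<^sub>R A + t *\<^sub>R B"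
proof -
  have nd: "s = 0 \<and> t = 0" if "\<And>z. s * Qf A z + t * Qf B z \<ge> 0" for s t
  proof -
    have "pos_semidef (s *\<^sub>R A + t *\<^sub>R B)"
      unfolding pos_semidef_def Qf_mform mform_combination
      using that symmetric_mat_combination[OF symA symB] by (simp add: Qf_mform)
    then have "s *\<^sub>R A + t *\<^sub>R B = 0" using nondiss unfolding non_dissipative_def by blast
    then show ?thesis using indep unfolding lin_indep2_def by blast
  qed
  have "finite {rank (s *\<^sub>R A + t *\<^sub>R B) | s t. True}"
    by (rule finite_subset[of _ "{..CARD('d + 'd)}"])
      (auto intro: order_trans[OF rank_bound])
  then have "maxrank A B \<in> {rank (s *\<^sub>R A + t *\<^sub>R B) | s t. True}"
    unfolding maxrank_def by (rule Max_in) auto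
  then obtain s0 t0 where s0: "rank (s0 *\<^sub>R A + t0 *\<^sub>R B) \<ge> 7" using rk by auto
  \<comment> \<open>The rank bound enters here: a pencil vanishing on a subspace of codimension at
    most two has rank at most 4.\<close>
  have nv: "\<exists>y. y \<bullet> u = 0 \<and> y \<bullet> v = 0 \<and> (Qf A y \<noteq> 0 \<or> Qf B y \<noteq> 0)" for u v
  proof (rule ccontr)
    assume *: "\<not> ?thesis"
    have "rank (s0 *\<^sub>R A + t0 *\<^sub>R B) \<le> 4"
      by (rule rank_le_4_of_vanishing[OF symmetric_mat_combination[OF symA symB], of u v])
        (use * in \<open>auto simp: Qf_mform mform_combination\<close>)
    with s0 show False by simp
  qed
  have "has_product_element (mform A) (mform B)"
    using regular_zero_or_product[OF mform_sym_bilinear[OF symA] mform_sym_bilinear[OF symB] nd[unfolded Qf_mform]]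
  proof
    assume "\<exists>z. regular_zero (mform A) (mform B) z"
    then obtain z where z: "regular_zero (mform A) (mform B) z" ..
    have "lin_indep2 (A *v z) (B *v z)"
      unfolding lin_indep2_def
    proof (intro allI impI)
      fix s t assume *: "s *\<^sub>R (A *v z) + t *\<^sub>R (B *v z) = 0"
      have "s * mform A z y + t * mform B z y = (s *\<^sub>R (A *v z) + t *\<^sub>R (B *v z)) \<bullet> y" for y
        by (simp add: mform_def mform_swap[OF symA] mform_swap[OF symB] inner_add_left)
      then have "\<forall>y. s * mform A z y + t * mform B z y = 0" using * by simp
      then show "s = 0 \<and> t = 0" using z unfolding regular_zero_def by blast
    qed
    moreover have "mform A z z = 0" "mform B z z = 0" using z unfolding regular_zero_def by blast+
    ultimately have "z \<in> Nset A B" by (simp add: Nset_def Qf_mform)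
    then show ?thesis using product_of_nonspanning_component[OF symA symB _ _ nv] nospan by blast
  qed
  then obtain s t f g where st: "s \<noteq> 0 \<or> t \<noteq> 0" "linear f" "linear g"
    "\<And>w. s * mform A w w + t * mform B w w = f w * g w"
    unfolding has_product_element_def by blast
  \<comment> \<open>The adjoints at 1 are the vectors representing the two linear forms.\<close>
  define l m where "l = adjoint f 1" and "m = adjoint g 1"
  have fg: "f w = l \<bullet> w" "g w = m \<bullet> w" for w
    using adjoint_works[OF st(2), of w 1] adjoint_works[OF st(3), of w 1]
    by (simp_all add: l_def m_def inner_commute)
  \<comment> \<open>\<open>G\<close> is the quarter-turn companion of \<open>M\<close> in the
    pencil, so the change of basis has the nonzero determinant \<open>r\<close>.\<close>
  define M G where "M = s *\<^sub>R A + t *\<^sub>R B" and "G = (- t) *\<^sub>R A + s *\<^sub>R B"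
  define r where "r = s\<^sup>2 + t\<^sup>2"
  have r: "r \<noteq> 0" using st(1) by (auto simp: r_def sum_power2_eq_zero_iff)
  have QM: "Qf M z = (l \<bullet> z) * (m \<bullet> z)" for z
    using st(4)[of z] by (simp add: M_def Qf_mform mform_combination fg)
  have QMG: "Qf M z = s * Qf A z + t * Qf B z" "Qf G z = s * Qf B z - t * Qf A z" for z
    unfolding M_def G_def Qf_combination by simp_all
  have QAB: "r * Qf A z = s * Qf M z - t * Qf G z" "r * Qf B z = t * Qf M z + s * Qf G z" for z
    by (simp_all add: QMG r_def power2_eq_square algebra_simps)
  have vec: "M *v z = s *\<^sub>R (A *v z) + t *\<^sub>R (B *v z)" "G *v z = (- t) *\<^sub>R (A *v z) + s *\<^sub>R (B *v z)" for z
    unfolding M_def G_def matrix_combination_vec by simp_all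
  have "r *\<^sub>R (A *v z) = s *\<^sub>R (M *v z) - t *\<^sub>R (G *v z)" "r *\<^sub>R (B *v z) = t *\<^sub>R (M *v z) + s *\<^sub>R (G *v z)" for z
    by (simp_all add: vec r_def power2_eq_square algebra_simps)
  then have ker: "M *v z = 0 \<and> G *v z = 0 \<longleftrightarrow> A *v z = 0 \<and> B *v z = 0" for z
    using r vec by (metis add_0 diff_self scaleR_eq_0_iff scaleR_zero_right)
  obtain y where y: "l \<bullet> y = 0" "m \<bullet> y = 0" "Qf A y \<noteq> 0 \<or> Qf B y \<noteq> 0"
    using nv[of l m] by (auto simp: inner_commute)
  have "\<exists>c. C = c *\<^sub>R M"
  proof (rule bracket_with_product_form[OF _ _ symC QM _ y(1,2)])
    show "symmetric_mat M" "symmetric_mat G"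
      unfolding M_def G_def by (intro symmetric_mat_combination symA symB)+
    show "a = 0 \<and> b = 0" if "\<And>z. a * Qf M z + b * Qf G z \<ge> 0" for a b
    proof -
      have "a * s - b * t = 0 \<and> a * t + b * s = 0"
        by (rule nd) (use that in \<open>simp add: QMG algebra_simps\<close>)
      then have 0: "a * s - b * t = 0" "a * t + b * s = 0" by blast+
      have "r * a = s * (a * s - b * t) + t * (a * t + b * s)"
        "r * b = s * (a * t + b * s) - t * (a * s - b * t)"
        by (simp_all add: r_def power2_eq_square algebra_simps)
      then show ?thesis using r unfolding 0 by simp
    qed
    show "Qf G y \<noteq> 0" using QAB[of y] QM[of y] y r by auto
    show "4 / r \<noteq> 0" using r by simp
    show "Qf C z = 4 / r * symp_form (M *v z) (G *v z)" for z
    proof -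
      have "s * s - t * - t = r" by (simp add: r_def power2_eq_square)
      then show ?thesis
        unfolding vec symp_form_combination using QC poisson_Qf[OF symA symB] r by simp
    qed
    show "Qf C z = 0" if "Qf M z = 0" "Qf G z = 0" for z
      using QAB[of z] that r vanish by simp
    show "u = 0" if "M *v u = 0" "G *v u = 0"
      "\<And>v. M *v v = 0 \<Longrightarrow> G *v v = 0 \<Longrightarrow> symp_form u v = 0" for u
      using kern
    proof
      assume "{z. A *v z = 0} \<inter> {z. B *v z = 0} = {0}"
      then show ?thesis using that(1,2) ker by blast
    next
      assume "symplectic_subspace ({z. A *v z = 0} \<inter> {z. B *v z = 0})"
      then show ?thesis using that ker unfolding symplectic_subspace_def by blast
    qed
  qed
  then obtain c where "C = c *\<^sub>R M" ..
  then have "C = (c * s) *\<^sub>R A + (c * t) *\<^sub>R B" by (simp add: M_def scaleR_add_right)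
  then show ?thesis by blast
qed

end
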